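(* Let $G$ be a finitely generated nilpotent group such that $G$ and $G/\mathrm{Torsion}(G)$ generate the same variety $\mathcal V$ (i.e. satisfy the same identities). Then, for all sufficiently large $k\in\mathbb N$, $G\rightsquigarrow \mathbb V_k$, where $\mathbb V_k$ is the relatively free group of rank $k$ in the variety $\mathcal V$.
   Context: For finitely generated groups $G,H$, write $G\rightsquigarrow H$ ("$G$ preforms $H$") if there exist a finite generating set $T$ of $H$ and a sequence $S_1,S_2,\dots$ of finite generating sets of $G$, with bijections $S_n\to T$, such that for every $R\in\mathbb N$ and all $n$ large enough the balls of radius $R$ around the identity in the Cayley graphs of $(G,S_n)$ and $(H,T)$ are isomorphic as rooted graphs with edges labelled by generators, labels being identified via $S_n\to T$. An identity for a group $G$ is a word $w(x_1,\dots,x_n)$ in a free group such that $w(g_1,\dots,g_n)=1$ for all $g_1,\dots,g_n\in G$. The variety generated by $G$ is determined by the set of identities satisfied by $G$. If $\mathcal V$ is a variety and $\mathbb F_k$ is the free group of rank $k$, then $\mathcal V(\mathbb F_k)$ is the verbal subgroup of $\mathbb F_k$ generated by all values in $\mathbb F_k$ of the identities of $\mathcal V$, and $\mathbb V_k=\mathbb F_k/\mathcal V(\mathbb F_k)$ is the relatively free group of rank $k$ in $\mathcal V$. $\mathrm{Torsion}(G)$ is the subgroup of torsion elements of the nilpotent group $G$. *)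

theory Defs
  imports "HOL-Algebra.Generated_Groups"
begin

section \<open>Generation, nilpotency, torsion\<close>

definition generates :: "('a, 'm) monoid_scheme \<Rightarrow> 'a set \<Rightarrow> bool"
  where "generates G S \<longleftrightarrow> S \<subseteq> carrier G \<and> generate G S = carrier G"

definition finitely_generated :: "('a, 'm) monoid_scheme \<Rightarrow> bool"
  where "finitely_generated G \<longleftrightarrow> (\<exists>S. finite S \<and> generates G S)"

primrec lower_central :: "('a, 'm) monoid_scheme \<Rightarrow> nat \<Rightarrow> 'a set"
  where
    "lower_central G 0 = carrier G"
  | "lower_central G (Suc n) = generate G
       {x \<otimes>\<^bsub>G\<^esub> y \<otimes>\<^bsub>G\<^esub> inv\<^bsub>G\<^esub> x \<otimes>\<^bsub>G\<^esub> inv\<^bsub>G\<^esub> y | x y. x \<in> lower_central G n \<and> y \<in> carrier G}"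

definition nilpotent_group :: "('a, 'm) monoid_scheme \<Rightarrow> bool"
  where "nilpotent_group G \<longleftrightarrow> group G \<and> (\<exists>c. lower_central G c = {\<one>\<^bsub>G\<^esub>})"

text \<open>For nilpotent groups this set is a normal subgroup; the definition itself does not presuppose it.\<close>

definition torsion_subgroup :: "('a, 'm) monoid_scheme \<Rightarrow> 'a set"
  where "torsion_subgroup G = {x \<in> carrier G. \<exists>n::nat. n > 0 \<and> x [^]\<^bsub>G\<^esub> n = \<one>\<^bsub>G\<^esub>}"

section \<open>Free groups\<close>

text \<open>
  The letter \<open>(x, True)\<close> stands for the generator \<open>x\<close>, and \<open>(x, False)\<close> for its inverse.
  Elements of the free group are the reduced words.
\<close>

type_synonym 'x word = "('x \<times> bool) list"

definition inv_letter :: "'x \<times> bool \<Rightarrow> 'x \<times> bool"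
  where "inv_letter l = (fst l, \<not> snd l)"

definition reduced :: "'x word \<Rightarrow> bool"
  where "reduced = successively (\<lambda>l l'. l' \<noteq> inv_letter l)"

fun reduced_Cons :: "'x \<times> bool \<Rightarrow> 'x word \<Rightarrow> 'x word"
  where
    "reduced_Cons l [] = [l]"
  | "reduced_Cons l (l' # w) = (if l' = inv_letter l then w else l # l' # w)"

definition free_group :: "'x set \<Rightarrow> 'x word monoid"
  where "free_group A =
    \<lparr>carrier = {w. reduced w \<and> fst ` set w \<subseteq> A},
     monoid.mult = (\<lambda>u v. foldr reduced_Cons u v),
     one = []\<rparr>"

primrec word_eval :: "('a, 'm) monoid_scheme \<Rightarrow> ('x \<Rightarrow> 'a) \<Rightarrow> 'x word \<Rightarrow> 'a"
  where
    "word_eval G g [] = \<one>\<^bsub>G\<^esub>"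
  | "word_eval G g (l # w) =
       (if snd l then g (fst l) else inv\<^bsub>G\<^esub> (g (fst l))) \<otimes>\<^bsub>G\<^esub> word_eval G g w"

subsection \<open>Group axioms and the universal property\<close>

lemma inv_letter_inv_letter [simp]: "inv_letter (inv_letter l) = l"
  by (simp add: inv_letter_def)

lemma fst_inv_letter [simp]: "fst (inv_letter l) = fst l"
  by (simp add: inv_letter_def)

lemma inv_letter_neq [simp]: "inv_letter l \<noteq> l" "l \<noteq> inv_letter l"
  by (cases l; simp add: inv_letter_def)+

lemma reduced_Nil [simp]: "reduced []"
  by (simp add: reduced_def)

lemma reduced_ConsD: "reduced (l # w) \<Longrightarrow> reduced w"
  by (cases w) (auto simp: reduced_def)

lemma reduced_reduced_Cons: "reduced w \<Longrightarrow> reduced (reduced_Cons l w)"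
  by (cases w) (auto simp: reduced_def intro: reduced_ConsD[unfolded reduced_def])

lemma reduced_foldr: "reduced w \<Longrightarrow> reduced (foldr reduced_Cons u w)"
  by (induction u) (auto intro: reduced_reduced_Cons)

lemma reduced_Cons_cancel:
  "reduced w \<Longrightarrow> reduced_Cons l (reduced_Cons (inv_letter l) w) = w"
proof (cases w)
  case (Cons a v)
  assume "reduced w"
  with Cons show ?thesis
    by (cases v) (auto simp: reduced_def)
qed simp

lemma reduced_Cons_reduced: "reduced (l # w) \<Longrightarrow> reduced_Cons l w = l # w"
  by (cases w) (auto simp: reduced_def)

lemma foldr_reduced_Cons_Nil: "reduced u \<Longrightarrow> foldr reduced_Cons u [] = u"
proof (induction u)
  case (Cons l u)
  then show ?case
    using reduced_ConsD[OF Cons.prems] reduced_Cons_reduced[OF Cons.prems] by simp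
qed simp

lemma foldr_reduced_Cons_step:
  "reduced w \<Longrightarrow>
    foldr reduced_Cons (reduced_Cons l u) w = reduced_Cons l (foldr reduced_Cons u w)"
  by (cases u) (auto simp: reduced_Cons_cancel reduced_foldr)

lemma foldr_reduced_Cons_assoc:
  "reduced w \<Longrightarrow>
    foldr reduced_Cons (foldr reduced_Cons u v) w =
    foldr reduced_Cons u (foldr reduced_Cons v w)"
  by (induction u) (auto simp: foldr_reduced_Cons_step)

lemma fst_set_reduced_Cons: "fst ` set (reduced_Cons l w) \<subseteq> insert (fst l) (fst ` set w)"
  by (cases w) auto

lemma fst_set_foldr_reduced_Cons:
  "fst ` set (foldr reduced_Cons u w) \<subseteq> fst ` set u \<union> fst ` set w"
proof (induction u)
  case (Cons l u)
  then show ?case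
    using fst_set_reduced_Cons[of l "foldr reduced_Cons u w"]
    unfolding foldr.simps o_apply list.set image_insert by blast
qed simp

lemma foldr_reduced_Cons_inverse:
  "reduced w \<Longrightarrow>
    foldr reduced_Cons (rev (map inv_letter u)) (foldr reduced_Cons u w) = w"
proof (induction u)
  case (Cons l u)
  then show ?case
    using reduced_Cons_cancel[OF reduced_foldr[OF Cons.prems], of "inv_letter l" u] by simp
qed simp

lemma foldr_reduced_Cons_left_inverse:
  assumes "reduced u"
  shows "foldr reduced_Cons (foldr reduced_Cons (rev (map inv_letter u)) []) u = []"
proof -
  have "foldr reduced_Cons (foldr reduced_Cons (rev (map inv_letter u)) []) u
      = foldr reduced_Cons (rev (map inv_letter u)) (foldr reduced_Cons [] u)"
    by (rule foldr_reduced_Cons_assoc[OF assms])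
  also have "\<dots> = foldr reduced_Cons (rev (map inv_letter u)) (foldr reduced_Cons u [])"
    using assms by (simp add: foldr_reduced_Cons_Nil)
  also have "\<dots> = []"
    by (rule foldr_reduced_Cons_inverse) simp
  finally show ?thesis .
qed

theorem group_free_group: "group (free_group A)"
proof (rule groupI)
  fix u v assume "u \<in> carrier (free_group A)" "v \<in> carrier (free_group A)"
  then show "u \<otimes>\<^bsub>free_group A\<^esub> v \<in> carrier (free_group A)"
    using order_trans[OF fst_set_foldr_reduced_Cons[of u v], of A]
    by (simp add: free_group_def reduced_foldr)
next
  fix u assume u: "u \<in> carrier (free_group A)"
  have "fst ` set (foldr reduced_Cons (rev (map inv_letter u)) []) \<subseteq> fst ` set u"
    using fst_set_foldr_reduced_Cons[of "rev (map inv_letter u)" "[]"] by (simp add: image_image)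
  with u show "\<exists>v\<in>carrier (free_group A). v \<otimes>\<^bsub>free_group A\<^esub> u = \<one>\<^bsub>free_group A\<^esub>"
    by (intro bexI[of _ "foldr reduced_Cons (rev (map inv_letter u)) []"])
      (auto simp: free_group_def foldr_reduced_Cons_left_inverse reduced_foldr)
qed (auto simp: free_group_def foldr_reduced_Cons_assoc)

lemma (in group) word_eval_closed:
  assumes "\<And>x. x \<in> fst ` set w \<Longrightarrow> g x \<in> carrier G"
  shows "word_eval G g w \<in> carrier G"
  using assms by (induction w) auto

lemma (in group) word_eval_reduced_Cons:
  assumes "\<And>x. x \<in> fst ` set (l # w) \<Longrightarrow> g x \<in> carrier G"
  shows "word_eval G g (reduced_Cons l w) = word_eval G g (l # w)"
proof (cases w)
  case (Cons l' v)
  have "word_eval G g v \<in> carrier G" "g (fst l) \<in> carrier G"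
    using assms Cons by (auto intro!: word_eval_closed)
  with Cons show ?thesis
    by (auto simp: inv_letter_def m_assoc[symmetric])
qed simp

lemma (in group) word_eval_foldr:
  assumes "\<And>x. x \<in> fst ` (set u \<union> set w) \<Longrightarrow> g x \<in> carrier G"
  shows "word_eval G g (foldr reduced_Cons u w) = word_eval G g u \<otimes> word_eval G g w"
  using assms
proof (induction u)
  case Nil
  then show ?case by (simp add: word_eval_closed)
next
  case (Cons l u)
  have "word_eval G g u \<in> carrier G" "word_eval G g w \<in> carrier G" "g (fst l) \<in> carrier G"
    using Cons.prems by (auto intro!: word_eval_closed)
  moreover have "word_eval G g (foldr reduced_Cons (l # u) w) =
      word_eval G g (l # foldr reduced_Cons u w)"
    unfolding foldr.simps o_apply
  proof (rule word_eval_reduced_Cons)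
    fix x assume "x \<in> fst ` set (l # foldr reduced_Cons u w)"
    then have "x \<in> fst ` (set (l # u) \<union> set w)"
      using fst_set_foldr_reduced_Cons[of u w] by auto
    then show "g x \<in> carrier G"
      by (rule Cons.prems)
  qed
  ultimately show ?case
    using Cons by (simp add: m_assoc)
qed

theorem (in group) word_eval_hom:
  assumes "g \<in> A \<rightarrow> carrier G"
  shows "word_eval G g \<in> hom (free_group A) G"
proof (rule homI)
  fix u assume "u \<in> carrier (free_group A)"
  with assms show "word_eval G g u \<in> carrier G"
    by (intro word_eval_closed) (auto simp: free_group_def)
next
  fix u v assume "u \<in> carrier (free_group A)" "v \<in> carrier (free_group A)"
  with assms show "word_eval G g (u \<otimes>\<^bsub>free_group A\<^esub> v) = word_eval G g u \<otimes> word_eval G g v"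
    by (simp add: free_group_def) (intro word_eval_foldr, auto)
qed

theorem (in group) word_eval_generator:
  "g x \<in> carrier G \<Longrightarrow> word_eval G g [(x, True)] = g x"
  by simp

section \<open>Identities, varieties and relatively free groups\<close>

text \<open>
  Identities are taken in the free group on \<open>x\<^sub>0, x\<^sub>1, \<dots>\<close>; each word involves only finitely many
  variables. A variety is represented by its set of identities.
\<close>

definition identities :: "('a, 'm) monoid_scheme \<Rightarrow> nat word set"
  where "identities G = {w \<in> carrier (free_group UNIV).
    \<forall>g \<in> UNIV \<rightarrow> carrier G. word_eval G g w = \<one>\<^bsub>G\<^esub>}"

definition verbal_subgroup :: "nat word set \<Rightarrow> ('a, 'm) monoid_scheme \<Rightarrow> 'a set"
  where "verbal_subgroup I G =
    generate G {word_eval G g w | g w. w \<in> I \<and> g \<in> UNIV \<rightarrow> carrier G}"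

definition relatively_free_group :: "nat word set \<Rightarrow> nat \<Rightarrow> nat word set monoid"
  where "relatively_free_group I k =
    free_group {..<k} Mod verbal_subgroup I (free_group {..<k})"

section \<open>Cayley graphs and preforming\<close>

text \<open>An edge \<open>(u, l, v)\<close> is directed from \<open>u\<close> to \<open>v\<close> and has label \<open>l\<close>.\<close>

record ('v, 'l) rooted_lgraph =
  vertices :: "'v set"
  edges :: "('v \<times> 'l \<times> 'v) set"
  root :: 'v

definition cayley_graph :: "('a, 'm) monoid_scheme \<Rightarrow> 'a set \<Rightarrow> ('a, 'a) rooted_lgraph"
  where "cayley_graph G S =
    \<lparr>vertices = carrier G,
     edges = {(x, s, x \<otimes>\<^bsub>G\<^esub> s) | x s. x \<in> carrier G \<and> s \<in> S},
     root = \<one>\<^bsub>G\<^esub>\<rparr>"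

text \<open>
  Distances ignore the direction of edges, so that in a Cayley graph they are word lengths with
  respect to \<open>S \<union> S\<^sup>-\<^sup>1\<close>. The ball is the induced subgraph.
\<close>

definition adjacency :: "('v, 'l) rooted_lgraph \<Rightarrow> 'v rel"
  where "adjacency \<Gamma> = {(u, v). \<exists>l. (u, l, v) \<in> edges \<Gamma> \<or> (v, l, u) \<in> edges \<Gamma>}"

definition ball_vertices :: "('v, 'l) rooted_lgraph \<Rightarrow> nat \<Rightarrow> 'v set"
  where "ball_vertices \<Gamma> R = {v \<in> vertices \<Gamma>. \<exists>n\<le>R. (root \<Gamma>, v) \<in> adjacency \<Gamma> ^^ n}"

definition root_ball :: "('v, 'l) rooted_lgraph \<Rightarrow> nat \<Rightarrow> ('v, 'l) rooted_lgraph"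
  where "root_ball \<Gamma> R =
    \<lparr>vertices = ball_vertices \<Gamma> R,
     edges = {(u, l, v) \<in> edges \<Gamma>. u \<in> ball_vertices \<Gamma> R \<and> v \<in> ball_vertices \<Gamma> R},
     root = root \<Gamma>\<rparr>"

definition lgraph_isomorphic_via ::
    "('l \<Rightarrow> 'm) \<Rightarrow> ('v, 'l) rooted_lgraph \<Rightarrow> ('w, 'm) rooted_lgraph \<Rightarrow> bool"
  where "lgraph_isomorphic_via \<phi> \<Gamma> \<Delta> \<longleftrightarrow>
    (\<exists>f. bij_betw f (vertices \<Gamma>) (vertices \<Delta>) \<and> f (root \<Gamma>) = root \<Delta> \<and>
         bij_betw (\<lambda>(u, l, v). (f u, \<phi> l, f v)) (edges \<Gamma>) (edges \<Delta>))"

definition preforms :: "('a, 'm) monoid_scheme \<Rightarrow> ('b, 'n) monoid_scheme \<Rightarrow> bool"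
    (infix \<open>\<leadsto>\<close> 50)
  where "G \<leadsto> H \<longleftrightarrow>
    (\<exists>T S \<phi>. finite T \<and> generates H T \<and>
       (\<forall>n::nat. finite (S n) \<and> generates G (S n) \<and> bij_betw (\<phi> n) (S n) T) \<and>
       (\<forall>R. \<exists>N. \<forall>n\<ge>N. lgraph_isomorphic_via (\<phi> n)
          (root_ball (cayley_graph G (S n)) R) (root_ball (cayley_graph H T) R)))"

end

theory Submission
  imports Defs "HOL-Computational_Algebra.Primes" "HOL-Algebra.Zassenhaus"
begin

text \<open>
  Since the verbal subgroup consists of the identities of \<open>G\<close> in \<open>k\<close> variables, it suffices to find,
  for every finite set \<open>W\<close> of words that are not identities, a generating \<open>k\<close>-tuple of \<open>G\<close> at which no
  word of \<open>W\<close> vanishes. By the hypothesis on identities, every word of \<open>W\<close> takes some value outside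
  the torsion subgroup \<open>T\<close>.

  For every prime \<open>q\<close>, each element outside \<open>T\<close> survives in a quotient of \<open>G / T\<close> of \<open>q\<close>-power exponent.
  Hence a value outside \<open>T\<close> stays outside \<open>T\<close> when the arguments are multiplied by \<open>q\<^sup>e\<close>-th powers
  with \<open>e\<close> large. Walking from \<open>t\<^sub>i\<close> to \<open>u\<^sub>i\<close> along \<open>t\<^sub>i (t\<^sub>i\<^sup>-\<^sup>1 u\<^sub>i)\<^sup>n\<close> with \<open>n\<close> close to \<open>0\<close> 2-adically and to
  \<open>1\<close> 3-adically merges good tuples for different words into a single good tuple \<open>t\<close>.

  Let \<open>g\<^sub>1, \<dots>, g\<^sub>d\<close> generate \<open>G\<close> and \<open>k \<ge> 2 d\<close>. Replacing \<open>d\<close> entries of \<open>t\<close> by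
  \<open>z\<^sub>i = g\<^sub>i (g\<^sub>i\<^sup>-\<^sup>1 t\<^sub>i)\<^sup>n\<close> with a suitable \<open>n \<ge> 2\<close>, the \<open>z\<^sub>i\<close> generate the abelianization modulo \<open>n\<close>, hence
  a subgroup containing all its \<open>m\<close>-th powers for some \<open>m > 0\<close>. Replacing \<open>d\<close> other entries by
  \<open>g\<^sub>i (g\<^sub>i\<^sup>-\<^sup>1 t\<^sub>i)\<^sup>N\<close> with \<open>m\<close> dividing \<open>N\<close> then gives a tuple generating the abelianization, and so \<open>G\<close>,
  because \<open>G\<close> is nilpotent. For \<open>N\<close> close to \<open>1\<close> \<open>q\<close>-adically, \<open>q\<close> a prime not dividing \<open>m\<close>, the
  values of the words in \<open>W\<close> remain outside \<open>T\<close>.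
\<close>

section \<open>Commutators and the lower central series\<close>

definition commutator :: "('a, 'm) monoid_scheme \<Rightarrow> 'a \<Rightarrow> 'a \<Rightarrow> 'a"
  where "commutator G x y = x \<otimes>\<^bsub>G\<^esub> y \<otimes>\<^bsub>G\<^esub> inv\<^bsub>G\<^esub> x \<otimes>\<^bsub>G\<^esub> inv\<^bsub>G\<^esub> y"

lemma lower_central_Suc:
  "lower_central G (Suc n) =
    generate G {commutator G x y | x y. x \<in> lower_central G n \<and> y \<in> carrier G}"
  by (simp add: commutator_def)

declare lower_central.simps(2) [simp del]

context group
begin

lemma inv_mult_cancel [simp]:
  assumes "x \<in> carrier G" "y \<in> carrier G"
  shows "x \<otimes> (inv x \<otimes> y) = y" "inv x \<otimes> (x \<otimes> y) = y"
  using assms by (simp_all flip: m_assoc)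

lemma commutator_closed [intro, simp]:
  "x \<in> carrier G \<Longrightarrow> y \<in> carrier G \<Longrightarrow> commutator G x y \<in> carrier G"
  by (simp add: commutator_def)

lemma commutator_mult_swap:
  assumes "x \<in> carrier G" "y \<in> carrier G"
  shows "commutator G x y \<otimes> (y \<otimes> x) = x \<otimes> y"
  using assms by (simp add: commutator_def m_assoc)

lemma commutator_eq_one_iff:
  assumes "x \<in> carrier G" "y \<in> carrier G"
  shows "commutator G x y = \<one> \<longleftrightarrow> x \<otimes> y = y \<otimes> x"
proof
  assume "commutator G x y = \<one>"
  with commutator_mult_swap[OF assms] assms show "x \<otimes> y = y \<otimes> x" by simp
next
  assume "x \<otimes> y = y \<otimes> x"
  with assms show "commutator G x y = \<one>" by (simp add: commutator_def m_assoc)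
qed

lemma inv_commute:
  assumes "c \<in> carrier G" "x \<in> carrier G" "c \<otimes> x = x \<otimes> c"
  shows "inv c \<otimes> x = x \<otimes> inv c"
proof -
  have "inv c \<otimes> (c \<otimes> x) \<otimes> inv c = inv c \<otimes> (x \<otimes> c) \<otimes> inv c"
    using assms(3) by simp
  with assms(1,2) show ?thesis by (simp add: m_assoc)
qed

lemma conjugate_commutator:
  assumes "g \<in> carrier G" "x \<in> carrier G" "y \<in> carrier G"
  shows "g \<otimes> commutator G x y \<otimes> inv g =
    commutator G (g \<otimes> x \<otimes> inv g) (g \<otimes> y \<otimes> inv g)"
  using assms by (simp add: commutator_def m_assoc inv_mult_group)

lemma conjugate_nat_pow:
  assumes "g \<in> carrier G" "x \<in> carrier G"
  shows "(g \<otimes> x \<otimes> inv g) [^] (n::nat) = g \<otimes> x [^] n \<otimes> inv g"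
  using assms by (induction n) (simp_all add: m_assoc)

lemma mult_commute:
  assumes "x \<in> carrier G" "a \<in> carrier G" "b \<in> carrier G"
    and "x \<otimes> a = a \<otimes> x" "x \<otimes> b = b \<otimes> x"
  shows "x \<otimes> (a \<otimes> b) = a \<otimes> b \<otimes> x"
proof -
  have "x \<otimes> (a \<otimes> b) = a \<otimes> x \<otimes> b"
    using assms(1-3) by (simp flip: m_assoc assms(4))
  also have "\<dots> = a \<otimes> (b \<otimes> x)"
    using assms(1-3) by (simp add: m_assoc assms(5))
  finally show ?thesis
    using assms(1-3) by (simp add: m_assoc)
qed

text \<open>Conjugation by \<open>y\<close> turns \<open>x\<close> into
  \<open>inv c \<otimes> x\<close>, where \<open>c\<close> is the commutator. As \<open>c\<close>
  commutes with \<open>x\<close>, powers of this product split into powers of the factors.\<close>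

lemma commutator_nat_pow_left:
  assumes xy: "x \<in> carrier G" "y \<in> carrier G"
    and c: "commutator G x y \<otimes> x = x \<otimes> commutator G x y"
  shows "commutator G (x [^] (n::nat)) y = commutator G x y [^] n"
proof -
  define c where "c = commutator G x y"
  have cc: "c \<in> carrier G" "c \<otimes> x = x \<otimes> c"
    using xy c by (auto simp: c_def)
  have com: "inv c \<otimes> x = x \<otimes> inv c"
    using cc xy inv_commute by blast
  have conj: "y \<otimes> x \<otimes> inv y = inv c \<otimes> x"
    using xy by (simp add: c_def commutator_def m_assoc inv_mult_group)
  have "y \<otimes> x [^] n \<otimes> inv y = inv c [^] n \<otimes> x [^] n"
    unfolding conjugate_nat_pow[OF xy(2,1), symmetric] conj
    using cc xy com by (intro pow_mult_distrib) auto
  then have "commutator G (x [^] n) y = x [^] n \<otimes> inv (inv c [^] n \<otimes> x [^] n)"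
    using xy by (simp add: commutator_def inv_mult_group m_assoc flip: \<open>y \<otimes> x [^] n \<otimes> inv y = inv c [^] n \<otimes> x [^] n\<close>)
  also have "\<dots> = c [^] n"
    using xy cc by (simp add: inv_mult_group nat_pow_inv)
  finally show ?thesis by (simp add: c_def)
qed

end

section \<open>Commutators modulo a normal subgroup\<close>

context normal
begin

lemma group_hom_Mod: "group_hom G (G Mod H) (\<lambda>a. H #> a)"
  using r_coset_hom_Mod factorgroup_is_group is_group
  by (simp add: group_hom_def group_hom_axioms_def)

lemma r_coset_eq_one_iff: "x \<in> carrier G \<Longrightarrow> H #> x = H \<longleftrightarrow> x \<in> H"
  using coset_join1 coset_join2 is_subgroup subset by blast

lemma nat_pow_r_coset: "x \<in> carrier G \<Longrightarrow> (H #> x) [^]\<^bsub>G Mod H\<^esub> (n::nat) = H #> (x [^] n)"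
  using group_hom.hom_nat_pow[OF group_hom_Mod] by simp

lemma r_coset_closed: "x \<in> carrier G \<Longrightarrow> H #> x \<in> carrier (G Mod H)"
  by (simp add: carrier_FactGroup)

lemma commutator_r_coset:
  assumes "x \<in> carrier G" "y \<in> carrier G"
  shows "commutator (G Mod H) (H #> x) (H #> y) = H #> commutator G x y"
proof -
  interpret h: group_hom G "G Mod H" "\<lambda>a. H #> a" by (rule group_hom_Mod)
  show ?thesis
    using assms unfolding commutator_def
    by (simp only: h.hom_mult h.hom_inv inv_closed m_closed)
qed

lemma commutator_mem_iff:
  assumes "x \<in> carrier G" "y \<in> carrier G"
  shows "commutator G x y \<in> H \<longleftrightarrow>
    (H #> x) \<otimes>\<^bsub>G Mod H\<^esub> (H #> y) = (H #> y) \<otimes>\<^bsub>G Mod H\<^esub> (H #> x)"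
proof -
  interpret Q: group "G Mod H" by (rule factorgroup_is_group)
  have "commutator G x y \<in> H \<longleftrightarrow> commutator (G Mod H) (H #> x) (H #> y) = \<one>\<^bsub>G Mod H\<^esub>"
    using assms by (simp add: commutator_r_coset r_coset_eq_one_iff)
  also have "\<dots> \<longleftrightarrow> (H #> x) \<otimes>\<^bsub>G Mod H\<^esub> (H #> y) = (H #> y) \<otimes>\<^bsub>G Mod H\<^esub> (H #> x)"
    using assms by (intro Q.commutator_eq_one_iff r_coset_closed)
  finally show ?thesis .
qed

text \<open>This is \<open>commutator_nat_pow_left\<close> in \<open>G Mod H\<close>, where the
  hypothesis makes the commutator commute with \<open>x\<close>. The lower central series uses it
  from right to left, the upper one from left to right.\<close>

lemma commutator_nat_pow_mem_iff:
  assumes xy: "x \<in> carrier G" "y \<in> carrier G"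
    and c: "commutator G (commutator G x y) x \<in> H"
  shows "commutator G x y [^] (n::nat) \<in> H \<longleftrightarrow> commutator G (x [^] n) y \<in> H"
proof -
  interpret Q: group "G Mod H" by (rule factorgroup_is_group)
  have "commutator (G Mod H) ((H #> x) [^]\<^bsub>G Mod H\<^esub> n) (H #> y) =
      commutator (G Mod H) (H #> x) (H #> y) [^]\<^bsub>G Mod H\<^esub> n"
    using xy c by (intro Q.commutator_nat_pow_left r_coset_closed)
      (simp_all only: commutator_r_coset commutator_mem_iff commutator_closed)
  then have "H #> commutator G (x [^] n) y = H #> (commutator G x y [^] n)"
    using xy by (simp add: nat_pow_r_coset commutator_r_coset)
  then show ?thesis
    using xy r_coset_eq_one_iff by (metis commutator_closed nat_pow_closed)
qed

lemma commutator_inv_swap: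
  assumes "x \<in> carrier G" "y \<in> carrier G" "commutator G x y \<in> H"
  shows "commutator G y x \<in> H"
  using assms commutator_mem_iff by metis

text \<open>The set is the preimage of the centralizer of the coset of \<open>x\<close> in
  \<open>G Mod H\<close>.\<close>

lemma subgroup_commuting:
  assumes x: "x \<in> carrier G"
  shows "subgroup {g \<in> carrier G. commutator G x g \<in> H} G"
proof -
  interpret h: group_hom G "G Mod H" "\<lambda>a. H #> a" by (rule group_hom_Mod)
  let ?C = "{g \<in> carrier G. (H #> x) \<otimes>\<^bsub>G Mod H\<^esub> (H #> g) = (H #> g) \<otimes>\<^bsub>G Mod H\<^esub> (H #> x)}"
  have "subgroup ?C G"
  proof (rule subgroupI)
    show "?C \<noteq> {}" using x by (auto intro!: exI[of _ x])
  next
    fix a assume a: "a \<in> ?C"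
    then have "inv\<^bsub>G Mod H\<^esub> (H #> a) \<otimes>\<^bsub>G Mod H\<^esub> (H #> x) =
        (H #> x) \<otimes>\<^bsub>G Mod H\<^esub> inv\<^bsub>G Mod H\<^esub> (H #> a)"
      using x by (intro h.H.inv_commute) (simp_all only: mem_Collect_eq h.hom_closed)
    then show "inv a \<in> ?C" using a
      by (simp only: mem_Collect_eq h.hom_inv inv_closed)
  next
    fix a b assume a: "a \<in> ?C" "b \<in> ?C"
    have "(H #> x) \<otimes>\<^bsub>G Mod H\<^esub> ((H #> a) \<otimes>\<^bsub>G Mod H\<^esub> (H #> b)) =
        ((H #> a) \<otimes>\<^bsub>G Mod H\<^esub> (H #> b)) \<otimes>\<^bsub>G Mod H\<^esub> (H #> x)"
      using x a by (intro h.H.mult_commute) (simp_all only: mem_Collect_eq h.hom_closed)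
    then show "a \<otimes> b \<in> ?C" using a by (simp only: h.hom_mult mem_Collect_eq m_closed)
  qed auto
  moreover have "?C = {g \<in> carrier G. commutator G x g \<in> H}"
    using x commutator_mem_iff by auto
  ultimately show ?thesis by simp
qed

text \<open>This is the preimage of the centre of \<open>G Mod H\<close>; normality of the terms of
  \<open>upper_central\<close> follows by induction.\<close>

lemma normal_central_preimage:
  "{y \<in> carrier G. \<forall>g\<in>carrier G. commutator G y g \<in> H} \<lhd> G"
proof (rule normal_invI)
  let ?Z = "{y \<in> carrier G. \<forall>g\<in>carrier G. commutator G y g \<in> H}"
  have eq: "?Z = (\<Inter>g\<in>carrier G. {y \<in> carrier G. commutator G g y \<in> H})"
    using commutator_inv_swap by auto
  show "subgroup ?Z G"
    unfolding eq by (rule subgroups_Inter) (use subgroup_commuting in auto)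
  fix y g assume "y \<in> ?Z" and g: "g \<in> carrier G"
  then have y: "y \<in> carrier G" "\<And>h. h \<in> carrier G \<Longrightarrow> commutator G y h \<in> H" by auto
  {
    fix h assume h: "h \<in> carrier G"
    \<comment> \<open>Writing \<open>h\<close> as a conjugate by \<open>g\<close> makes its
      commutator with the conjugated \<open>y\<close> a conjugate of a commutator of
      \<open>y\<close> itself.\<close>
    have "h = g \<otimes> (inv g \<otimes> h \<otimes> g) \<otimes> inv g"
      using g h by (simp add: m_assoc)
    then have "commutator G (g \<otimes> y \<otimes> inv g) h = g \<otimes> commutator G y (inv g \<otimes> h \<otimes> g) \<otimes> inv g"
      using y g h conjugate_commutator[of g y "inv g \<otimes> h \<otimes> g"] by simp
    then have "commutator G (g \<otimes> y \<otimes> inv g) h \<in> H"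
      using y g h inv_op_closed2 by auto
  }
  then show "g \<otimes> y \<otimes> inv g \<in> ?Z" using y g by auto
qed

end

section \<open>Powers along the lower central series\<close>

context group
begin

text \<open>Conjugation maps the generators of each term to generators, because the preceding term
  is normal.\<close>

lemma lower_central_normal: "lower_central G n \<lhd> G"
proof (induction n)
  case 0
  then show ?case by (simp add: normal_self)
next
  case (Suc n)
  interpret L: normal "lower_central G n" G by (rule Suc)
  show ?case
    unfolding lower_central_Suc
  proof (rule normal_generateI)
    fix h g
    assume "h \<in> {commutator G x y |x y. x \<in> lower_central G n \<and> y \<in> carrier G}"
      and g: "g \<in> carrier G"
    then obtain x y where "h = commutator G x y" "x \<in> lower_central G n" "y \<in> carrier G" by auto
    with g show "g \<otimes> h \<otimes> inv g \<in> {commutator G x y |x y. x \<in> lower_central G n \<and> y \<in> carrier G}"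
      using conjugate_commutator[of g x y] L.inv_op_closed2[of g x]
      by (simp add: L.mem_carrier) (blast intro: inv_closed m_closed)
  qed (auto simp: L.mem_carrier)
qed

lemma lower_central_Suc_mem:
  "x \<in> lower_central G n \<Longrightarrow> y \<in> carrier G \<Longrightarrow> commutator G x y \<in> lower_central G (Suc n)"
  unfolding lower_central_Suc by (rule generate.incl) auto

text \<open>Modulo \<open>N\<close> the elements of \<open>M\<close> commute, so the
  \<open>n\<close>-th power map is multiplicative there, and the set is its kernel.\<close>

lemma subgroup_nat_pow_mem_of_commuting:
  assumes N: "N \<lhd> G" and M: "subgroup M G"
    and com: "\<And>x y. x \<in> M \<Longrightarrow> y \<in> M \<Longrightarrow> commutator G x y \<in> N"
  shows "subgroup {x \<in> M. x [^] (n::nat) \<in> N} G"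
proof -
  interpret N: normal N G by (rule N)
  interpret M: subgroup M G by (rule M)
  interpret h: group_hom G "G Mod N" "\<lambda>a. N #> a" by (rule N.group_hom_Mod)
  let ?C = "{x \<in> M. x [^] n \<in> N}"
  have eq: "x \<in> ?C \<longleftrightarrow> x \<in> M \<and> (N #> x) [^]\<^bsub>G Mod N\<^esub> n = \<one>\<^bsub>G Mod N\<^esub>" for x
  proof (cases "x \<in> M")
    case True
    then have "x \<in> carrier G" by (rule M.mem_carrier)
    with True show ?thesis by (simp add: N.nat_pow_r_coset N.r_coset_eq_one_iff)
  qed simp
  show ?thesis
  proof (rule subgroupI)
    show "?C \<noteq> {}" by (auto intro!: exI[of _ \<one>])
  next
    fix a b assume "a \<in> ?C" "b \<in> ?C"
    then have ab: "a \<in> M" "b \<in> M" "a \<in> carrier G" "b \<in> carrier G"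
      "(N #> a) [^]\<^bsub>G Mod N\<^esub> n = \<one>\<^bsub>G Mod N\<^esub>" "(N #> b) [^]\<^bsub>G Mod N\<^esub> n = \<one>\<^bsub>G Mod N\<^esub>"
      unfolding eq using M.mem_carrier by auto
    have "((N #> a) \<otimes>\<^bsub>G Mod N\<^esub> (N #> b)) [^]\<^bsub>G Mod N\<^esub> n = \<one>\<^bsub>G Mod N\<^esub>"
      using ab com[of a b] N.commutator_mem_iff[of a b]
      by (subst h.H.pow_mult_distrib)
        (simp_all only: h.hom_closed h.H.one_closed h.H.l_one)
    then show "a \<otimes> b \<in> ?C"
      unfolding eq using ab by (simp only: h.hom_mult M.m_closed)
  next
    fix a assume "a \<in> ?C"
    then show "inv a \<in> ?C" using M.mem_carrier by (auto simp: nat_pow_inv)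
  qed (use M.mem_carrier in auto)
qed

text \<open>Each term is commutative modulo the next, so generators suffice. For
  \<open>i = 0\<close> these are the elements of \<open>S\<close>. Later they are commutators of
  \<open>x\<close> and \<open>y\<close>, whose \<open>n\<close>-th power agrees, modulo the target
  term, with the commutator of \<open>x [^] n\<close> and \<open>y\<close>, and
  \<open>x [^] n\<close> already lies one term deeper than \<open>x\<close>.\<close>

lemma nat_pow_mem_lower_central:
  assumes S: "generates G S" and n: "\<And>s. s \<in> S \<Longrightarrow> s [^] (n::nat) = \<one>"
  shows "x \<in> lower_central G i \<Longrightarrow> x [^] n \<in> lower_central G (Suc i)"
proof (induction i arbitrary: x)
  case 0
  interpret L: normal "lower_central G (Suc 0)" G by (rule lower_central_normal)
  have "subgroup {x \<in> carrier G. x [^] n \<in> lower_central G (Suc 0)} G"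
    by (rule subgroup_nat_pow_mem_of_commuting)
      (auto intro: lower_central_normal subgroup_self lower_central_Suc_mem)
  then have "generate G S \<subseteq> {x \<in> carrier G. x [^] n \<in> lower_central G (Suc 0)}"
    using S n by (intro generate_subgroup_incl) (auto simp: generates_def)
  then show ?case using S 0 by (auto simp: generates_def)
next
  case (Suc i)
  interpret L: normal "lower_central G i" G by (rule lower_central_normal)
  interpret M: normal "lower_central G (Suc i)" G by (rule lower_central_normal)
  interpret N: normal "lower_central G (Suc (Suc i))" G by (rule lower_central_normal)
  have "subgroup {x \<in> lower_central G (Suc i). x [^] n \<in> lower_central G (Suc (Suc i))} G"
    by (rule subgroup_nat_pow_mem_of_commuting)
      (auto intro: lower_central_normal lower_central_Suc_mem M.is_subgroup M.mem_carrier)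
  moreover have "commutator G x y [^] n \<in> lower_central G (Suc (Suc i))"
    if "x \<in> lower_central G i" "y \<in> carrier G" for x y
    using that Suc.IH[of x] L.mem_carrier[of x]
    by (subst N.commutator_nat_pow_mem_iff) (auto intro!: lower_central_Suc_mem)
  ultimately have "lower_central G (Suc i) \<subseteq>
      {x \<in> lower_central G (Suc i). x [^] n \<in> lower_central G (Suc (Suc i))}"
    by (subst lower_central_Suc, intro generate_subgroup_incl)
      (auto intro: lower_central_Suc_mem)
  then show ?case using Suc.prems by auto
qed

text \<open>Every \<open>n\<close>-th power descends one term of the lower central series; after
  \<open>c\<close> of them the trivial term is reached.\<close>

lemma nilpotent_exponent:
  assumes "generates G S" "\<And>s. s \<in> S \<Longrightarrow> s [^] (n::nat) = \<one>"
    and "lower_central G c = {\<one>}" "x \<in> carrier G"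
  shows "x [^] (n ^ c) = \<one>"
proof -
  have "x [^] (n ^ i) \<in> lower_central G i" for i
  proof (induction i)
    case (Suc i)
    then show ?case
      using nat_pow_mem_lower_central[OF assms(1,2), of "x [^] (n ^ i)" i] assms(4)
      by (simp add: nat_pow_pow mult.commute)
  qed (use assms in auto)
  then show ?thesis using assms(3) by blast
qed

end

section \<open>Torsion and exponents of nilpotent groups\<close>

text \<open>Each term is the preimage of the centre of the quotient by the previous one, written
  with commutators to avoid iterated quotients.\<close>

primrec upper_central :: "('a, 'm) monoid_scheme \<Rightarrow> nat \<Rightarrow> 'a set"
  where
    "upper_central G 0 = {\<one>\<^bsub>G\<^esub>}"
  | "upper_central G (Suc n) =
      {y \<in> carrier G. \<forall>g\<in>carrier G. commutator G y g \<in> upper_central G n}"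

context group
begin

lemma upper_central_normal: "upper_central G n \<lhd> G"
  by (induction n) (auto intro: one_is_normal normal.normal_central_preimage)

text \<open>Going up one term in the lower series costs one term in the upper series. For
  \<open>i = c\<close> the upper series reaches the whole group.\<close>

lemma lower_central_subset_upper_central:
  assumes "lower_central G c = {\<one>}"
  shows "i \<le> c \<Longrightarrow> lower_central G (c - i) \<subseteq> upper_central G i"
proof (induction i)
  case (Suc i)
  interpret L: normal "lower_central G (c - Suc i)" G by (rule lower_central_normal)
  have "commutator G y g \<in> upper_central G i" if "y \<in> lower_central G (c - Suc i)" "g \<in> carrier G" for y g
    using lower_central_Suc_mem[OF that] Suc by (auto simp: Suc_diff_Suc)
  then show ?case using L.mem_carrier by auto
qed (use assms in auto)

text \<open>Commutators and generated subgroups computed in \<open>H\<close> agree with those of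
  \<open>G\<close>, so each lower central term of \<open>H\<close> lies in the corresponding term of
  \<open>G\<close>.\<close>

lemma nilpotent_subgroup:
  assumes H: "subgroup H G" and c: "lower_central G c = {\<one>}"
  shows "lower_central (G\<lparr>carrier := H\<rparr>) c = {\<one>}"
proof -
  interpret K: group "G\<lparr>carrier := H\<rparr>" by (rule subgroup_imp_group[OF H])
  have HG: "H \<subseteq> carrier G" using H by (rule subgroup.subset)
  have LK: "lower_central (G\<lparr>carrier := H\<rparr>) i \<subseteq> H" for i
    using normal_imp_subgroup[OF K.lower_central_normal[of i]] subgroup.subset by fastforce
  have "lower_central (G\<lparr>carrier := H\<rparr>) i \<subseteq> lower_central G i" for i
  proof (induction i)
    case (Suc i)
    let ?X = "{commutator (G\<lparr>carrier := H\<rparr>) x y | x y. x \<in> lower_central (G\<lparr>carrier := H\<rparr>) i \<and> y \<in> H}"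
    have eq: "commutator (G\<lparr>carrier := H\<rparr>) x y = commutator G x y" if "x \<in> H" "y \<in> H" for x y
      using that m_inv_consistent[OF H] by (simp add: commutator_def)
    have "?X \<subseteq> H"
      using K.commutator_closed LK by fastforce
    then have "generate (G\<lparr>carrier := H\<rparr>) ?X = generate G ?X"
      by (intro generate_consistent H)
    also have "\<dots> \<subseteq> lower_central G (Suc i)"
    proof (rule generate_subgroup_incl)
      show "?X \<subseteq> lower_central G (Suc i)"
      proof
        fix z assume "z \<in> ?X"
        then obtain x y where z: "z = commutator (G\<lparr>carrier := H\<rparr>) x y"
          "x \<in> lower_central (G\<lparr>carrier := H\<rparr>) i" "y \<in> H" by blast
        then have "z = commutator G x y" "x \<in> lower_central G i" "y \<in> carrier G"
          using eq[of x y] LK[of i] Suc HG by auto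
        then show "z \<in> lower_central G (Suc i)" by (simp add: lower_central_Suc_mem)
      qed
    qed (rule normal_imp_subgroup[OF lower_central_normal])
    finally show ?case by (simp add: lower_central_Suc)
  qed (use HG in simp)
  moreover have "\<one> \<in> lower_central (G\<lparr>carrier := H\<rparr>) c"
    using subgroup.one_closed[OF normal_imp_subgroup[OF K.lower_central_normal[of c]]] by simp
  ultimately show ?thesis using c by blast
qed

lemma nat_pow_eq_one_of_dvd:
  assumes "x [^] (m::nat) = \<one>" "m dvd n" "x \<in> carrier G"
  shows "x [^] n = \<one>"
  using assms by (auto simp: dvd_def simp flip: nat_pow_pow)

text \<open>Two torsion elements generate a nilpotent subgroup whose generators are killed by
  \<open>m * n\<close>. By \<open>nilpotent_exponent\<close> that subgroup has finite exponent, so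
  the product of the two elements is torsion.\<close>

lemma torsion_subgroup_normal:
  assumes "nilpotent_group G"
  shows "torsion_subgroup G \<lhd> G"
proof (rule normal_invI)
  obtain c where c: "lower_central G c = {\<one>}"
    using assms by (auto simp: nilpotent_group_def)
  show "subgroup (torsion_subgroup G) G"
  proof (rule subgroupI)
    show "torsion_subgroup G \<noteq> {}"
      by (auto simp: torsion_subgroup_def intro!: exI[of _ \<one>] exI[of _ 1])
  next
    fix a assume "a \<in> torsion_subgroup G"
    then show "inv a \<in> torsion_subgroup G"
      by (auto simp: torsion_subgroup_def nat_pow_inv)
  next
    fix a b assume "a \<in> torsion_subgroup G" "b \<in> torsion_subgroup G"
    then obtain m n :: nat where ab: "a \<in> carrier G" "b \<in> carrier G"
      and mn: "m > 0" "a [^] m = \<one>" "n > 0" "b [^] n = \<one>"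
      by (auto simp: torsion_subgroup_def)
    define H where "H = generate G {a, b}"
    have H: "subgroup H G" unfolding H_def using ab by (intro generate_is_subgroup) auto
    interpret K: group "G\<lparr>carrier := H\<rparr>" by (rule subgroup_imp_group[OF H])
    have abH: "a \<in> H" "b \<in> H" by (auto simp: H_def intro: generate.incl)
    have gen: "generates (G\<lparr>carrier := H\<rparr>) {a, b}"
      using abH generate_consistent[OF _ H, of "{a, b}"] by (simp add: generates_def H_def[symmetric])
    have p: "a [^] (m * n) = \<one>" "b [^] (m * n) = \<one>"
      using ab mn nat_pow_eq_one_of_dvd by auto
    have "(a \<otimes> b) [^]\<^bsub>G\<lparr>carrier := H\<rparr>\<^esub> ((m * n) ^ c) = \<one>\<^bsub>G\<lparr>carrier := H\<rparr>\<^esub>"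
      by (rule K.nilpotent_exponent[OF gen])
        (use p abH nilpotent_subgroup[OF H c] subgroup.m_closed[OF H]
          in \<open>auto simp flip: nat_pow_consistent\<close>)
    then have "(a \<otimes> b) [^] ((m * n) ^ c) = \<one>"
      by (simp flip: nat_pow_consistent)
    then show "a \<otimes> b \<in> torsion_subgroup G"
      unfolding torsion_subgroup_def using ab mn by (auto intro!: exI[of _ "(m * n) ^ c"])
  qed (auto simp: torsion_subgroup_def)
next
  fix x h assume "x \<in> carrier G" "h \<in> torsion_subgroup G"
  then show "x \<otimes> h \<otimes> inv x \<in> torsion_subgroup G"
    by (auto simp: torsion_subgroup_def conjugate_nat_pow)
qed

end

context normal
begin

lemma lower_central_Mod:
  assumes c: "lower_central G c = {\<one>}"
  shows "lower_central (G Mod H) c = {\<one>\<^bsub>G Mod H\<^esub>}"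
proof -
  interpret h: group_hom G "G Mod H" "\<lambda>a. H #> a" by (rule group_hom_Mod)
  have "lower_central (G Mod H) i \<subseteq> (\<lambda>a. H #> a) ` lower_central G i" for i
  proof (induction i)
    case (Suc i)
    show ?case
      unfolding lower_central_Suc[of "G Mod H"]
    proof (rule h.H.generate_subgroup_incl)
      show "subgroup ((\<lambda>a. H #> a) ` lower_central G (Suc i)) (G Mod H)"
        by (intro h.subgroup_img_is_subgroup normal_imp_subgroup lower_central_normal)
      show "{commutator (G Mod H) x y |x y. x \<in> lower_central (G Mod H) i \<and> y \<in> carrier (G Mod H)}
        \<subseteq> (\<lambda>a. H #> a) ` lower_central G (Suc i)"
      proof
        fix z assume "z \<in> {commutator (G Mod H) x y |x y.
          x \<in> lower_central (G Mod H) i \<and> y \<in> carrier (G Mod H)}"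
        then obtain x y where z: "z = commutator (G Mod H) (H #> x) (H #> y)"
          "x \<in> lower_central G i" "y \<in> carrier G"
          using Suc by (auto simp: carrier_FactGroup)
        moreover have "x \<in> carrier G"
          using z(2) normal_imp_subgroup[OF lower_central_normal[of i]] subgroup.mem_carrier by fast
        ultimately have "z = H #> commutator G x y" "commutator G x y \<in> lower_central G (Suc i)"
          by (simp_all add: commutator_r_coset lower_central_Suc_mem)
        then show "z \<in> (\<lambda>a. H #> a) ` lower_central G (Suc i)" by blast
      qed
    qed
  qed (simp add: carrier_FactGroup)
  then have "lower_central (G Mod H) c \<subseteq> {\<one>\<^bsub>G Mod H\<^esub>}"
    using c h.hom_one by (metis image_empty image_insert)
  moreover have "\<one>\<^bsub>G Mod H\<^esub> \<in> lower_central (G Mod H) c"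
    using subgroup.one_closed[OF normal_imp_subgroup[OF h.H.lower_central_normal[of c]]] .
  ultimately show ?thesis by blast
qed

lemma generates_Mod:
  assumes "generates G S"
  shows "generates (G Mod H) ((\<lambda>a. H #> a) ` S)"
  using assms group_hom.generate_img[OF group_hom_Mod, of S]
  by (auto simp: generates_def carrier_FactGroup)

end

section \<open>From the orders of central elements to the exponent of the group\<close>

context group
begin

lemma int_pow_eq_oneD:
  assumes "x [^] (z::int) = \<one>" "x \<in> carrier G"
  shows "x [^] nat \<bar>z\<bar> = \<one>"
proof (cases "z \<ge> 0")
  case True
  then show ?thesis using assms(1) pow_nat[of z G x] by simp
next
  case False
  then have "z = - int (nat \<bar>z\<bar>)" by simp
  then have "inv (x [^] nat \<bar>z\<bar>) = \<one>"
    using assms int_pow_neg_int by metis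
  then show ?thesis using assms(2) by simp
qed

lemma normal_generate_central:
  assumes "y \<in> carrier G" "\<And>g. g \<in> carrier G \<Longrightarrow> y \<otimes> g = g \<otimes> y"
  shows "generate G {y} \<lhd> G"
proof (rule normal_generateI)
  fix h g assume "h \<in> {y}" and g: "g \<in> carrier G"
  moreover have "g \<otimes> y \<otimes> inv g = y \<otimes> g \<otimes> inv g"
    using assms(2)[OF g] by simp
  ultimately show "g \<otimes> h \<otimes> inv g \<in> {y}"
    using assms(1) by (simp add: m_assoc)
qed (use assms in auto)

text \<open>A nontrivial central element generates a normal subgroup, so by \<open>xN\<close> some
  \<open>x [^] m\<close> with \<open>q\<close> not dividing \<open>m\<close> is one of its powers.
  Used for \<open>y\<close> and for a power of \<open>x\<close>, this bounds the order of
  \<open>y\<close>; used for the part of \<open>y\<close> of order prime to \<open>q\<close>, it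
  shows that this part is trivial.\<close>

lemma central_exponent:
  assumes q: "prime (q::nat)" and x: "x \<in> carrier G"
    and x1: "\<And>n::nat. x [^] n = \<one> \<Longrightarrow> q dvd n"
    and xN: "\<And>N. N \<lhd> G \<Longrightarrow> N \<noteq> {\<one>} \<Longrightarrow> \<exists>n::nat. x [^] n \<in> N \<and> \<not> q dvd n"
    and y: "y \<in> carrier G" "\<And>g. g \<in> carrier G \<Longrightarrow> y \<otimes> g = g \<otimes> y"
  shows "\<exists>j. y [^] (q ^ j) = \<one>"
proof -
  have meet: "\<exists>(m::nat) (i::int). x [^] m = z [^] i \<and> \<not> q dvd m"
    if z: "z \<in> carrier G" "\<And>g. g \<in> carrier G \<Longrightarrow> z \<otimes> g = g \<otimes> z" "z \<noteq> \<one>" for z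
  proof -
    have "z \<in> generate G {z}" by (auto intro: generate.incl)
    then show ?thesis
      using xN[OF normal_generate_central[OF z(1,2)]] z(3) generate_pow[OF z(1)] by auto
  qed
  have x1': "int q dvd z" if "x [^] (z::int) = \<one>" for z
    using x1[OF int_pow_eq_oneD[OF that x]] by (simp add: dvd_nat_abs_iff)
  have com: "y [^] (i::nat) \<otimes> g = g \<otimes> y [^] i" if "g \<in> carrier G" for i g
    using y that by (metis group_commutes_pow)
  have comi: "y [^] (i::int) \<otimes> g = g \<otimes> y [^] i" if "g \<in> carrier G" for i g
  proof (cases i rule: int_cases2)
    case (nonneg n)
    then show ?thesis using com[OF that] by (simp add: int_pow_int)
  next
    case (nonpos n)
    then show ?thesis
      using inv_commute[OF _ that com[OF that]] y(1) by (simp add: int_pow_neg_int)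
  qed
  have "\<exists>N::nat. N > 0 \<and> y [^] N = \<one>"
  proof (cases "y = \<one>")
    case False
    then obtain m i where m: "x [^] (m::nat) = y [^] (i::int)" "\<not> q dvd m"
      using meet[OF y] by blast
    \<comment> \<open>Otherwise some \<open>x [^] n\<close> with \<open>q\<close> not dividing
      \<open>n\<close> is a power of \<open>x [^] (m * q)\<close>, and comparing exponents of
      \<open>x\<close> makes \<open>q\<close> divide \<open>n\<close>.\<close>
    have "(x [^] m) [^] q = \<one>"
    proof (rule ccontr)
      assume ne: "(x [^] m) [^] q \<noteq> \<one>"
      have "(x [^] m) [^] q \<otimes> g = g \<otimes> (x [^] m) [^] q" if "g \<in> carrier G" for g
        unfolding m(1) using comi that y(1) by (intro group_commutes_pow) auto
      then obtain n j where n: "x [^] (n::nat) = ((x [^] m) [^] q) [^] (j::int)" "\<not> q dvd n"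
        using meet[of "(x [^] m) [^] q"] ne x by auto
      have "x [^] int n = x [^] (int (m * q) * j)"
        using n(1) x by (simp add: nat_pow_pow int_pow_pow flip: int_pow_int)
      then have "x [^] (int n - int (m * q) * j) = \<one>"
        using x by (simp add: int_pow_diff)
      then have "int q dvd int n - int (m * q) * j" by (rule x1')
      then have "int q dvd int n"
        by (metis dvd_add_right_iff dvd_mult2 dvd_triv_right diff_add_cancel dvd_diff of_nat_mult add.commute)
      with n(2) show False by simp
    qed
    then have "y [^] (i * int q) = \<one>"
      unfolding m(1) using y(1) by (simp add: int_pow_pow flip: int_pow_int)
    \<comment> \<open>For \<open>i = 0\<close> the power \<open>x [^] m\<close> would be trivial,
      and \<open>q\<close> would divide \<open>m\<close>.\<close>
    moreover have "i \<noteq> 0"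
      using m x1[of m] by auto
    ultimately show ?thesis
      using int_pow_eq_oneD[OF _ y(1)] prime_gt_0_nat[OF q]
      by (intro exI[of _ "nat \<bar>i * int q\<bar>"]) auto
  qed (auto intro!: exI[of _ 1])
  then obtain N :: nat where N: "N > 0" "y [^] N = \<one>" by blast
  obtain l where l: "N = q ^ multiplicity q N * l" "\<not> q dvd l"
    using multiplicity_decompose'[of N q] N(1) q by (metis not_prime_unit less_numeral_extra(3))
  define j where "j = multiplicity q N"
  have yl: "(y [^] (q ^ j)) [^] l = \<one>"
    using N(2) l(1) y(1) by (simp add: nat_pow_pow j_def)
  have "y [^] (q ^ j) = \<one>"
  proof (rule ccontr)
    assume "y [^] (q ^ j) \<noteq> \<one>"
    then obtain m i where m: "x [^] (m::nat) = (y [^] (q ^ j)) [^] (i::int)" "\<not> q dvd m"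
      using meet[of "y [^] (q ^ j)"] y(1) com by auto
    have "x [^] (m * l) = ((y [^] (q ^ j)) [^] i) [^] int l"
      using x by (simp add: int_pow_int flip: nat_pow_pow m(1))
    also have "\<dots> = ((y [^] (q ^ j)) [^] int l) [^] i"
      using y(1) by (simp add: int_pow_pow mult.commute)
    also have "\<dots> = \<one>"
      by (simp add: int_pow_int yl)
    finally have "q dvd m * l" by (rule x1)
    with q m(2) l(2) show False by (simp add: prime_dvd_mult_iff)
  qed
  then show ?thesis by blast
qed

lemma uniform_prime_power:
  assumes "finite X" "X \<subseteq> carrier G" "\<And>x. x \<in> X \<Longrightarrow> \<exists>j. x [^] ((q::nat) ^ j) = \<one>"
  shows "\<exists>j. \<forall>x\<in>X. x [^] (q ^ j) = \<one>"
proof -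
  obtain f where f: "\<And>x. x \<in> X \<Longrightarrow> x [^] (q ^ f x) = \<one>"
    using assms(3) by metis
  have "x [^] (q ^ (\<Sum>x\<in>X. f x)) = \<one>" if "x \<in> X" for x
    using f[OF that] assms(1,2) that
    by (intro nat_pow_eq_one_of_dvd[OF f[OF that]] le_imp_power_dvd) (auto intro: member_le_sum)
  then show ?thesis by blast
qed

text \<open>The hypothesis on central elements climbs the upper central series. If \<open>y\<close>
  lies in the term after \<open>upper_central G i\<close>, one power \<open>q ^ j\<close> kills its
  commutators with all \<open>s \<in> S\<close>. Modulo the term before
  \<open>upper_central G i\<close> these powers are the commutators of \<open>y [^] (q ^ j)\<close>,
  which therefore drops one term. Finally \<open>nilpotent_exponent\<close> passes from
  \<open>S\<close> to all of \<open>G\<close>.\<close>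

lemma prime_power_exponent:
  assumes c: "lower_central G c = {\<one>}" and S: "finite S" "generates G S"
    and cen: "\<And>y. y \<in> carrier G \<Longrightarrow> (\<And>g. g \<in> carrier G \<Longrightarrow> y \<otimes> g = g \<otimes> y) \<Longrightarrow>
      \<exists>j. y [^] ((q::nat) ^ j) = \<one>"
  shows "\<exists>e. \<forall>g\<in>carrier G. g [^] (q ^ e) = \<one>"
proof -
  have up: "\<exists>j. y [^] (q ^ j) = \<one>" if "y \<in> upper_central G i" for i y
    using that
  proof (induction i arbitrary: y)
    case 0
    then show ?case by auto
  next
    case (Suc i)
    from Suc.prems have y: "y \<in> carrier G" "\<And>g. g \<in> carrier G \<Longrightarrow> commutator G y g \<in> upper_central G i"
      by auto
    show ?case
    proof (cases i)
      case 0
      then show ?thesis using y cen[of y] by (auto simp: commutator_eq_one_iff)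
    next
      case (Suc i')
      interpret U: normal "upper_central G i'" G by (rule upper_central_normal)
      have SG: "S \<subseteq> carrier G" "generate G S = carrier G" using S by (auto simp: generates_def)
      have "\<exists>j. \<forall>x\<in>commutator G y ` S. x [^] (q ^ j) = \<one>"
        using S SG y Suc.IH by (intro uniform_prime_power) auto
      then obtain j where j: "\<And>s. s \<in> S \<Longrightarrow> commutator G y s [^] (q ^ j) = \<one>" by auto
      have "commutator G (y [^] (q ^ j)) s \<in> upper_central G i'" if "s \<in> S" for s
      proof -
        have sG: "s \<in> carrier G" using that SG by auto
        have "commutator G (commutator G y s) y \<in> upper_central G i'"
          using y(2)[OF sG] y(1) \<open>i = Suc i'\<close> by simp
        then show ?thesis
          using j[OF that] U.commutator_nat_pow_mem_iff[OF y(1) sG, of "q ^ j"] by simp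
      qed
      \<comment> \<open>The elements that commute with \<open>y [^] (q ^ j)\<close> modulo the lower
        term form a subgroup, so testing on \<open>S\<close> suffices.\<close>
      then have "generate G S \<subseteq> {g \<in> carrier G. commutator G (y [^] (q ^ j)) g \<in> upper_central G i'}"
        using SG y(1) by (intro generate_subgroup_incl U.subgroup_commuting) auto
      then have "y [^] (q ^ j) \<in> upper_central G i"
        using SG y(1) \<open>i = Suc i'\<close> by auto
      then obtain j' where "(y [^] (q ^ j)) [^] (q ^ j') = \<one>" using Suc.IH by blast
      then show ?thesis
        using y(1) by (auto simp: nat_pow_pow simp flip: power_add)
    qed
  qed
  have "\<exists>j. g [^] (q ^ j) = \<one>" if "g \<in> carrier G" for g
    using up[of g c] lower_central_subset_upper_central[OF c, of c] that by auto
  moreover have SG: "S \<subseteq> carrier G" using S by (simp add: generates_def)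
  ultimately obtain j where j: "\<And>s. s \<in> S \<Longrightarrow> s [^] (q ^ j) = \<one>"
    using uniform_prime_power[OF S(1) SG, of q] by blast
  have "g [^] (q ^ (j * c)) = \<one>" if "g \<in> carrier G" for g
    using nilpotent_exponent[OF S(2) j c that] by (simp add: power_mult)
  then show ?thesis by blast
qed

end

section \<open>Residual properties and words\<close>

lemma (in normal) normal_preimage_Mod:
  assumes "N \<lhd> (G Mod H)"
  shows "{g \<in> carrier G. H #> g \<in> N} \<lhd> G"
proof (rule normal_invI)
  interpret h: group_hom G "G Mod H" "\<lambda>a. H #> a" by (rule group_hom_Mod)
  interpret N: normal N "G Mod H" by (rule assms)
  show "subgroup {g \<in> carrier G. H #> g \<in> N} G"
  proof (rule subgroupI)
    show "{g \<in> carrier G. H #> g \<in> N} \<noteq> {}"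
      using N.one_closed h.hom_one by (auto intro!: exI[of _ \<one>])
  next
    fix a assume "a \<in> {g \<in> carrier G. H #> g \<in> N}"
    then show "inv a \<in> {g \<in> carrier G. H #> g \<in> N}"
      using h.hom_inv[of a] N.m_inv_closed[of "H #> a"] by simp
  next
    fix a b assume "a \<in> {g \<in> carrier G. H #> g \<in> N}" "b \<in> {g \<in> carrier G. H #> g \<in> N}"
    then show "a \<otimes> b \<in> {g \<in> carrier G. H #> g \<in> N}"
      using h.hom_mult[of a b] N.m_closed[of "H #> a" "H #> b"] by simp
  qed auto
  fix x y assume x: "x \<in> carrier G" and "y \<in> {g \<in> carrier G. H #> g \<in> N}"
  then have y: "y \<in> carrier G" "H #> y \<in> N" by auto
  have "H #> (x \<otimes> y \<otimes> inv x) =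
      (H #> x) \<otimes>\<^bsub>G Mod H\<^esub> (H #> y) \<otimes>\<^bsub>G Mod H\<^esub> inv\<^bsub>G Mod H\<^esub> (H #> x)"
    using x y by (simp only: h.hom_mult h.hom_inv inv_closed m_closed)
  also have "\<dots> \<in> N"
    using x y(2) by (intro N.inv_op_closed2 r_coset_closed)
  finally show "x \<otimes> y \<otimes> inv x \<in> {g \<in> carrier G. H #> g \<in> N}"
    using x y by simp
qed

context group
begin

lemma normal_Union_chain:
  assumes ne: "\<C> \<noteq> {}" and nor: "\<And>K. K \<in> \<C> \<Longrightarrow> K \<lhd> G"
    and ch: "\<And>K K'. K \<in> \<C> \<Longrightarrow> K' \<in> \<C> \<Longrightarrow> K \<subseteq> K' \<or> K' \<subseteq> K"
  shows "\<Union>\<C> \<lhd> G"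
proof (rule normal_invI)
  have sub: "subgroup K G" if "K \<in> \<C>" for K using nor[OF that] by (rule normal_imp_subgroup)
  show "subgroup (\<Union>\<C>) G"
  proof (rule subgroupI)
    show "\<Union>\<C> \<subseteq> carrier G" using sub subgroup.subset by blast
    show "\<Union>\<C> \<noteq> {}" using ne sub subgroup.one_closed by blast
    fix a assume "a \<in> \<Union>\<C>"
    then obtain K where "K \<in> \<C>" "a \<in> K" by blast
    with subgroup.m_inv_closed[OF sub[of K]] show "inv a \<in> \<Union>\<C>" by blast
  next
    fix a b assume "a \<in> \<Union>\<C>" "b \<in> \<Union>\<C>"
    then obtain K where "K \<in> \<C>" "a \<in> K" "b \<in> K" using ch by blast
    with subgroup.m_closed[OF sub[of K]] show "a \<otimes> b \<in> \<Union>\<C>" by blast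
  qed
  fix x h assume x: "x \<in> carrier G" and "h \<in> \<Union>\<C>"
  then obtain K where "K \<in> \<C>" "h \<in> K" by blast
  with normal.inv_op_closed2[OF nor[of K] x] show "x \<otimes> h \<otimes> inv x \<in> \<Union>\<C>" by blast
qed

text \<open>A normal subgroup maximal among those meeting the powers of \<open>x\<close> only in \<open>q\<close>-th powers
  has a quotient whose centre consists of elements of \<open>q\<close>-power order.\<close>

lemma residually_prime_power_exponent:
  assumes nil: "nilpotent_group G" and S: "finite S" "generates G S"
    and q: "prime (q::nat)" and L: "L \<lhd> G"
    and x: "x \<in> carrier G" "\<And>n::nat. x [^] n \<in> L \<Longrightarrow> q dvd n"
  shows "\<exists>K e. K \<lhd> G \<and> L \<subseteq> K \<and> x \<notin> K \<and> (\<forall>g\<in>carrier G. g [^] (q ^ e) \<in> K)"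
proof -
  obtain c where c: "lower_central G c = {\<one>}"
    using nil by (auto simp: nilpotent_group_def)
  define \<A> where "\<A> = {K. K \<lhd> G \<and> L \<subseteq> K \<and> (\<forall>n::nat. x [^] n \<in> K \<longrightarrow> q dvd n)}"
  have "\<exists>M\<in>\<A>. \<forall>X\<in>\<A>. M \<subseteq> X \<longrightarrow> X = M"
  proof (rule subset_Zorn_nonempty)
    show "\<A> \<noteq> {}" using L x by (auto simp: \<A>_def)
    fix \<C> assume C: "\<C> \<noteq> {}" "subset.chain \<A> \<C>"
    then have CA: "\<C> \<subseteq> \<A>" and ch: "\<And>K K'. K \<in> \<C> \<Longrightarrow> K' \<in> \<C> \<Longrightarrow> K \<subseteq> K' \<or> K' \<subseteq> K"
      by (auto simp: subset_chain_def)
    have "\<Union>\<C> \<lhd> G"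
      using C(1) CA ch by (intro normal_Union_chain) (auto simp: \<A>_def)
    then show "\<Union>\<C> \<in> \<A>" using C(1) CA by (auto simp: \<A>_def)
  qed
  then obtain K where KA: "K \<in> \<A>" and Kmax: "\<And>X. X \<in> \<A> \<Longrightarrow> K \<subseteq> X \<Longrightarrow> X = K" by blast
  then have K: "K \<lhd> G" "L \<subseteq> K" "\<And>n::nat. x [^] n \<in> K \<Longrightarrow> q dvd n" by (auto simp: \<A>_def)
  interpret K: normal K G by (rule K(1))
  interpret Q: group "G Mod K" by (rule K.factorgroup_is_group)
  have "x \<notin> K" using K(3)[of 1] x(1) q by auto
  have "\<exists>e. \<forall>g\<in>carrier (G Mod K). g [^]\<^bsub>G Mod K\<^esub> (q ^ e) = \<one>\<^bsub>G Mod K\<^esub>"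
  proof (rule Q.prime_power_exponent)
    show "lower_central (G Mod K) c = {\<one>\<^bsub>G Mod K\<^esub>}" by (rule K.lower_central_Mod[OF c])
    show "finite ((\<lambda>a. K #> a) ` S)" using S by simp
    show "generates (G Mod K) ((\<lambda>a. K #> a) ` S)" by (rule K.generates_Mod[OF S(2)])
    fix y assume y: "y \<in> carrier (G Mod K)"
      "\<And>g. g \<in> carrier (G Mod K) \<Longrightarrow> y \<otimes>\<^bsub>G Mod K\<^esub> g = g \<otimes>\<^bsub>G Mod K\<^esub> y"
    show "\<exists>j. y [^]\<^bsub>G Mod K\<^esub> (q ^ j) = \<one>\<^bsub>G Mod K\<^esub>"
    proof (rule Q.central_exponent[OF q, of "K #> x"])
      show "K #> x \<in> carrier (G Mod K)" using x by (intro K.r_coset_closed)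
      show "q dvd n" if "(K #> x) [^]\<^bsub>G Mod K\<^esub> n = \<one>\<^bsub>G Mod K\<^esub>" for n :: nat
        using that x(1) K(3)[of n] by (simp add: K.nat_pow_r_coset K.r_coset_eq_one_iff)
    next
      fix N assume N: "N \<lhd> (G Mod K)" "N \<noteq> {\<one>\<^bsub>G Mod K\<^esub>}"
      interpret N: normal N "G Mod K" by (rule N(1))
      \<comment> \<open>The preimage \<open>P\<close> is normal and properly contains
        \<open>K\<close>, so maximality of \<open>K\<close> puts into \<open>P\<close> a power of
        \<open>x\<close> whose exponent is not divisible by \<open>q\<close>.\<close>
      define P where "P = {g \<in> carrier G. K #> g \<in> N}"
      have KP: "K \<subseteq> P"
      proof
        fix g assume g: "g \<in> K"
        then have "K #> g = K" by (simp add: K.r_coset_eq_one_iff K.mem_carrier)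
        with g show "g \<in> P" using N.one_closed by (simp add: P_def K.mem_carrier)
      qed
      have "P \<noteq> K"
      proof
        assume PK: "P = K"
        have "N \<subseteq> {K}"
        proof
          fix z assume z: "z \<in> N"
          then obtain g where g: "g \<in> carrier G" "z = K #> g"
            using N.mem_carrier by (auto simp: carrier_FactGroup)
          then have "g \<in> K" using z PK by (auto simp: P_def)
          then show "z \<in> {K}" using g K.r_coset_eq_one_iff by simp
        qed
        then show False using N(2) N.one_closed by auto
      qed
      then have "P \<notin> \<A>" using Kmax KP by blast
      moreover have "P \<lhd> G" unfolding P_def by (rule K.normal_preimage_Mod[OF N(1)])
      ultimately obtain n :: nat where n: "x [^] n \<in> P" "\<not> q dvd n"
        using KP K(2) by (auto simp: \<A>_def)
      then show "\<exists>n::nat. (K #> x) [^]\<^bsub>G Mod K\<^esub> n \<in> N \<and> \<not> q dvd n"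
        using x(1) by (auto simp: P_def K.nat_pow_r_coset)
    qed (use y in auto)
  qed
  then obtain e where e: "\<And>g. g \<in> carrier (G Mod K) \<Longrightarrow> g [^]\<^bsub>G Mod K\<^esub> (q ^ e) = \<one>\<^bsub>G Mod K\<^esub>" by blast
  have "g [^] (q ^ e) \<in> K" if "g \<in> carrier G" for g
    using e[OF K.r_coset_closed[OF that]] that by (simp add: K.nat_pow_r_coset K.r_coset_eq_one_iff)
  then show ?thesis using K(1,2) \<open>x \<notin> K\<close> by blast
qed

end

lemma (in group_hom) word_eval_hom_image:
  assumes "\<And>x. x \<in> fst ` set w \<Longrightarrow> t x \<in> carrier G"
  shows "word_eval H (\<lambda>x. h (t x)) w = h (word_eval G t w)"
  using assms
proof (induction w)
  case (Cons l w)
  then have "t (fst l) \<in> carrier G" "word_eval G t w \<in> carrier G"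
    by (auto intro!: G.word_eval_closed)
  with Cons show ?case by simp
qed simp

section \<open>Stability of nontorsion values under perturbation of the arguments\<close>

context group
begin

text \<open>Take a normal subgroup \<open>K\<close> that contains the torsion and all
  \<open>q ^ e\<close>-th powers but not the value of \<open>w\<close>. The two tuples, hence the
  two values, agree modulo \<open>K\<close>.\<close>

lemma nontorsion_perturb_single:
  assumes nil: "nilpotent_group G" and fg: "finitely_generated G" and q: "prime (q::nat)"
    and t: "t \<in> UNIV \<rightarrow> carrier G" and w: "word_eval G t w \<notin> torsion_subgroup G"
  shows "\<exists>e. \<forall>t'. (\<forall>i. \<exists>h\<in>carrier G. t' i = t i \<otimes> h [^] (q ^ e)) \<longrightarrow>
    word_eval G t' w \<notin> torsion_subgroup G"
proof -
  obtain S where S: "finite S" "generates G S" using fg by (auto simp: finitely_generated_def)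
  define x where "x = word_eval G t w"
  have x: "x \<in> carrier G" unfolding x_def using t by (intro word_eval_closed) auto
  \<comment> \<open>Only \<open>n = 0\<close> occurs: if a positive power of \<open>x\<close> is
    torsion, so is \<open>x\<close>.\<close>
  have "q dvd n" if tor: "x [^] n \<in> torsion_subgroup G" for n :: nat
  proof (cases "n = 0")
    case False
    obtain m :: nat where "m > 0" "x [^] (n * m) = \<one>"
      using tor x by (auto simp: torsion_subgroup_def nat_pow_pow)
    with False x have "x \<in> torsion_subgroup G"
      unfolding torsion_subgroup_def by (auto intro!: exI[of _ "n * m"])
    with w show ?thesis by (simp add: x_def)
  qed auto
  then obtain K e where K: "K \<lhd> G" "torsion_subgroup G \<subseteq> K" "x \<notin> K"
    and e: "\<And>g. g \<in> carrier G \<Longrightarrow> g [^] (q ^ e) \<in> K"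
    using residually_prime_power_exponent[OF nil S q torsion_subgroup_normal[OF nil] x] by metis
  interpret K: normal K G by (rule K(1))
  interpret h: group_hom G "G Mod K" "\<lambda>a. K #> a" by (rule K.group_hom_Mod)
  have "word_eval G t' w \<notin> torsion_subgroup G"
    if t': "\<forall>i. \<exists>h\<in>carrier G. t' i = t i \<otimes> h [^] (q ^ e)" for t'
  proof
    assume "word_eval G t' w \<in> torsion_subgroup G"
    then have inK: "word_eval G t' w \<in> K" using K(2) by blast
    have t'G: "t' i \<in> carrier G" for i
      using t' t by (metis PiE UNIV_I m_closed nat_pow_closed)
    have "K #> t' i = K #> t i" for i
    proof -
      obtain h where h: "h \<in> carrier G" "t' i = t i \<otimes> h [^] (q ^ e)" using t' by blast
      have ti: "t i \<in> carrier G" using t by auto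
      have "K #> t' i = (K #> t i) \<otimes>\<^bsub>G Mod K\<^esub> (K #> h [^] (q ^ e))"
        unfolding h(2) using h(1) ti by (intro h.hom_mult) auto
      also have "K #> h [^] (q ^ e) = \<one>\<^bsub>G Mod K\<^esub>"
        using e[OF h(1)] h(1) by (simp add: K.r_coset_eq_one_iff)
      finally show ?thesis using h.H.r_one[OF h.hom_closed[OF ti]] by simp
    qed
    then have "K #> word_eval G t' w = K #> word_eval G t w"
      using h.word_eval_hom_image[of w t'] h.word_eval_hom_image[of w t] t t'G by (auto simp: Pi_iff)
    moreover have "K #> word_eval G t' w = K" using inK K.mem_carrier by (simp add: K.r_coset_eq_one_iff)
    ultimately have "x \<in> K" using K.r_coset_eq_one_iff[OF x] by (simp add: x_def)
    with K(3) show False by simp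
  qed
  then show ?thesis by blast
qed

text \<open>Exponents for single words add up, since a \<open>q ^ (e1 + e2)\<close>-th power is both
  a \<open>q ^ e1\<close>-th and a \<open>q ^ e2\<close>-th power.\<close>

lemma nontorsion_perturb:
  assumes nil: "nilpotent_group G" and fg: "finitely_generated G" and q: "prime (q::nat)"
    and t: "t \<in> UNIV \<rightarrow> carrier G"
  shows "finite W \<Longrightarrow> (\<And>w. w \<in> W \<Longrightarrow> word_eval G t w \<notin> torsion_subgroup G) \<Longrightarrow>
    \<exists>e. \<forall>t'. (\<forall>i. \<exists>h\<in>carrier G. t' i = t i \<otimes> h [^] (q ^ e)) \<longrightarrow>
      (\<forall>w\<in>W. word_eval G t' w \<notin> torsion_subgroup G)"
proof (induction W rule: finite_induct)
  case (insert w W)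
  obtain e1 where e1: "\<And>t'. \<forall>i. \<exists>h\<in>carrier G. t' i = t i \<otimes> h [^] (q ^ e1) \<Longrightarrow>
      \<forall>w\<in>W. word_eval G t' w \<notin> torsion_subgroup G"
    using insert by (metis insertI2)
  obtain e2 where e2: "\<And>t'. \<forall>i. \<exists>h\<in>carrier G. t' i = t i \<otimes> h [^] (q ^ e2) \<Longrightarrow>
      word_eval G t' w \<notin> torsion_subgroup G"
    using nontorsion_perturb_single[OF nil fg q t, of w] insert.prems by blast
  have "\<forall>w\<in>insert w W. word_eval G t' w \<notin> torsion_subgroup G"
    if t': "\<forall>i. \<exists>h\<in>carrier G. t' i = t i \<otimes> h [^] (q ^ (e1 + e2))" for t'
  proof -
    have "\<exists>h\<in>carrier G. t' i = t i \<otimes> h [^] (q ^ e1)" "\<exists>h\<in>carrier G. t' i = t i \<otimes> h [^] (q ^ e2)" for i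
    proof -
      obtain h where h: "h \<in> carrier G" "t' i = t i \<otimes> h [^] (q ^ (e1 + e2))" using t' by blast
      then have "t' i = t i \<otimes> (h [^] (q ^ e2)) [^] (q ^ e1)" "t' i = t i \<otimes> (h [^] (q ^ e1)) [^] (q ^ e2)"
        by (simp_all add: nat_pow_pow power_add mult.commute)
      with h(1) show "\<exists>h\<in>carrier G. t' i = t i \<otimes> h [^] (q ^ e1)"
        "\<exists>h\<in>carrier G. t' i = t i \<otimes> h [^] (q ^ e2)" by blast+
    qed
    then show ?thesis using e1[of t'] e2[of t'] by blast
  qed
  then show ?case by blast
qed auto

lemma nontorsion_simultaneous:
  assumes nil: "nilpotent_group G" and fg: "finitely_generated G"
  shows "finite W \<Longrightarrow>
    (\<And>w. w \<in> W \<Longrightarrow> \<exists>t\<in>UNIV \<rightarrow> carrier G. word_eval G t w \<notin> torsion_subgroup G) \<Longrightarrow>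
    \<exists>t\<in>UNIV \<rightarrow> carrier G. \<forall>w\<in>W. word_eval G t w \<notin> torsion_subgroup G"
proof (induction W rule: finite_induct)
  case empty
  show ?case by (auto intro!: bexI[of _ "\<lambda>_. \<one>"])
next
  case (insert w W)
  obtain t where t: "t \<in> UNIV \<rightarrow> carrier G" "\<And>w. w \<in> W \<Longrightarrow> word_eval G t w \<notin> torsion_subgroup G"
    using insert by (metis insertI2)
  obtain u where u: "u \<in> UNIV \<rightarrow> carrier G" "word_eval G u w \<notin> torsion_subgroup G"
    using insert.prems by blast
  have "prime (2::nat)" "prime (3::nat)" by auto
  obtain e1 where e1: "\<And>t'. \<forall>i. \<exists>h\<in>carrier G. t' i = t i \<otimes> h [^] (2 ^ e1 :: nat) \<Longrightarrow>
      \<forall>w\<in>W. word_eval G t' w \<notin> torsion_subgroup G"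
    using nontorsion_perturb[OF nil fg \<open>prime (2::nat)\<close> t(1) insert.hyps(1)] t(2) by blast
  obtain e2 where e2: "\<And>t'. \<forall>i. \<exists>h\<in>carrier G. t' i = u i \<otimes> h [^] (3 ^ e2 :: nat) \<Longrightarrow>
      word_eval G t' w \<notin> torsion_subgroup G"
    using nontorsion_perturb_single[OF nil fg \<open>prime (3::nat)\<close> u] by blast
  have "coprime (2 ^ e1 :: nat) (3 ^ e2)" by simp
  \<comment> \<open>The exponent \<open>2 ^ e1 * x\<close> is 0 modulo \<open>2 ^ e1\<close> and 1
    modulo \<open>3 ^ e2\<close>. As \<open>t i \<otimes> b i = u i\<close>, the tuple
    \<open>s\<close> below is an admissible perturbation of both \<open>t\<close> and
    \<open>u\<close>.\<close>
  then obtain x y :: nat where xy: "2 ^ e1 * x = 3 ^ e2 * y + 1"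
    using bezout_nat[of "2 ^ e1" "3 ^ e2"] by auto
  define b where "b i = inv (t i) \<otimes> u i" for i
  define s where "s i = t i \<otimes> b i [^] (2 ^ e1 * x)" for i
  have G: "t i \<in> carrier G" "u i \<in> carrier G" "b i \<in> carrier G" for i
    using t(1) u(1) by (auto simp: b_def)
  have s1: "s i = t i \<otimes> (b i [^] x) [^] (2 ^ e1 :: nat)" for i
    using G[of i] by (simp add: s_def nat_pow_pow mult.commute)
  have s2: "s i = u i \<otimes> (b i [^] y) [^] (3 ^ e2 :: nat)" for i
  proof -
    have "s i = t i \<otimes> (b i \<otimes> b i [^] (3 ^ e2 * y))"
      unfolding s_def xy using G[of i] nat_pow_mult[of "b i" 1] by (simp add: nat_pow_comm[symmetric])
    also have "\<dots> = u i \<otimes> (b i [^] y) [^] (3 ^ e2 :: nat)"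
      using G[of i] by (simp add: b_def m_assoc[symmetric] nat_pow_pow mult.commute)
    finally show ?thesis .
  qed
  have "\<forall>w\<in>W. word_eval G s w \<notin> torsion_subgroup G" using s1 G by (intro e1) blast
  moreover have "word_eval G s w \<notin> torsion_subgroup G" using s2 G by (intro e2) blast
  moreover have "s \<in> UNIV \<rightarrow> carrier G" using G by (auto simp: s_def)
  ultimately show ?case by blast
qed

end

section \<open>Generating tuples outside torsion\<close>

context group
begin

text \<open>In \<open>x \<otimes> y\<close> and in \<open>y \<otimes> x\<close>, whose quotient is
  the commutator, the central factors collect on the right and cancel.\<close>

lemma commutator_central_factors:
  assumes xy: "x \<in> carrier G" "y \<in> carrier G" and ab: "a \<in> carrier G" "b \<in> carrier G"
    and a: "\<And>g. g \<in> carrier G \<Longrightarrow> a \<otimes> g = g \<otimes> a"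
    and b: "\<And>g. g \<in> carrier G \<Longrightarrow> b \<otimes> g = g \<otimes> b"
  shows "commutator G (x \<otimes> a) (y \<otimes> b) = commutator G x y"
proof -
  have shift: "(u \<otimes> c) \<otimes> (v \<otimes> d) = (u \<otimes> v) \<otimes> (c \<otimes> d)"
    if "u \<in> carrier G" "v \<in> carrier G" "c \<in> carrier G" "d \<in> carrier G" "c \<otimes> v = v \<otimes> c" for u v c d
  proof -
    have "(u \<otimes> c) \<otimes> (v \<otimes> d) = u \<otimes> (c \<otimes> v) \<otimes> d"
      using that(1-4) by (simp add: m_assoc)
    then show ?thesis
      using that(1-4) by (simp add: m_assoc that(5))
  qed
  have alt: "commutator G u v = (u \<otimes> v) \<otimes> inv (v \<otimes> u)" if "u \<in> carrier G" "v \<in> carrier G" for u v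
    using that by (simp add: commutator_def inv_mult_group m_assoc)
  have "commutator G (x \<otimes> a) (y \<otimes> b) = (x \<otimes> y) \<otimes> (a \<otimes> b) \<otimes> inv ((y \<otimes> x) \<otimes> (b \<otimes> a))"
    using xy ab shift[OF xy ab a[OF xy(2)]] shift[OF xy(2,1) ab(2,1) b[OF xy(1)]] by (simp add: alt)
  also have "b \<otimes> a = a \<otimes> b" using a[OF ab(2)] by simp
  finally show ?thesis
    using xy ab by (simp add: alt inv_mult_group m_assoc)
qed

text \<open>Subgroups containing deeper and deeper terms of the lower central series are handled in turn:
  if \<open>G\<close> is the product of \<open>H\<close> and a subgroup central modulo \<open>H\<close>, then all commutators lie in \<open>H\<close>.\<close>

lemma subgroup_eq_carrier_of_abelianization:
  assumes c: "lower_central G c = {\<one>}" and H: "subgroup H G"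
    and ab: "\<And>g. g \<in> carrier G \<Longrightarrow> \<exists>h\<in>H. inv h \<otimes> g \<in> lower_central G 1"
  shows "H = carrier G"
proof -
  \<comment> \<open>The induction keeps \<open>H\<close> arbitrary, because the induction hypothesis
    is applied to the larger subgroup \<open>?M\<close>.\<close>
  have step: "H = carrier G"
    if "subgroup H G" "lower_central G i \<subseteq> H"
      and "\<And>g. g \<in> carrier G \<Longrightarrow> \<exists>h\<in>H. inv h \<otimes> g \<in> lower_central G 1" for i H
    using that
  proof (induction i arbitrary: H)
    case 0
    then show ?case using subgroup.subset by force
  next
    case (Suc i)
    interpret H: subgroup H G by (rule Suc.prems(1))
    have base: "H = carrier G" if D: "lower_central G 1 \<subseteq> H"
    proof -
      have "g \<in> H" if g: "g \<in> carrier G" for g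
      proof -
        obtain h where h: "h \<in> H" "inv h \<otimes> g \<in> lower_central G 1"
          using Suc.prems(3)[OF g] by blast
        then have "h \<otimes> (inv h \<otimes> g) \<in> H" using D by blast
        then show ?thesis using h(1) g H.mem_carrier by simp
      qed
      then show ?thesis using H.subset by blast
    qed
    show ?case
    proof (cases i)
      case 0
      then show ?thesis using base Suc.prems(2) by simp
    next
      case i: (Suc i')
      interpret L: normal "lower_central G i" G by (rule lower_central_normal)
      interpret N: normal "lower_central G (Suc i)" G by (rule lower_central_normal)
      interpret Q: group "G Mod lower_central G (Suc i)" by (rule N.factorgroup_is_group)
      let ?M = "lower_central G i <#> H"
      have M: "subgroup ?M G" by (rule mult_norm_subgroup[OF lower_central_normal Suc.prems(1)])
      have HM: "H \<subseteq> ?M"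
      proof
        fix h assume h: "h \<in> H"
        then have "h = \<one> \<otimes> h" using H.mem_carrier by simp
        with h L.one_closed show "h \<in> ?M" unfolding set_mult_def by blast
      qed
      have LM: "lower_central G i \<subseteq> ?M"
      proof
        fix a assume a: "a \<in> lower_central G i"
        then have "a = a \<otimes> \<one>" using L.mem_carrier by simp
        with a H.one_closed show "a \<in> ?M" unfolding set_mult_def by blast
      qed
      have "?M = carrier G"
        using Suc.prems(3) HM by (intro Suc.IH M LM) blast
      \<comment> \<open>Elements of \<open>?M\<close> have the factor from \<open>H\<close> on the
        right; decomposing \<open>inv g\<close> moves it to the left, as
        \<open>commutator_central_factors\<close> expects.\<close>
      then have form: "\<exists>h\<in>H. \<exists>a\<in>lower_central G i. g = h \<otimes> a" if g: "g \<in> carrier G" for g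
      proof -
        have "inv g \<in> ?M" using \<open>?M = carrier G\<close> g by simp
        then obtain a h where ah: "a \<in> lower_central G i" "h \<in> H" "inv g = a \<otimes> h"
          by (auto simp: set_mult_def)
        then have "g = inv h \<otimes> inv a"
          using g by (metis H.mem_carrier L.mem_carrier inv_inv inv_mult_group)
        then show ?thesis using ah by blast
      qed
      have cen: "(lower_central G (Suc i) #> a) \<otimes>\<^bsub>G Mod lower_central G (Suc i)\<^esub> g =
          g \<otimes>\<^bsub>G Mod lower_central G (Suc i)\<^esub> (lower_central G (Suc i) #> a)"
        if ag: "a \<in> lower_central G i" "g \<in> carrier (G Mod lower_central G (Suc i))" for a g
      proof -
        obtain g' where g': "g' \<in> carrier G" "g = lower_central G (Suc i) #> g'"
          using ag(2) by (auto simp: carrier_FactGroup)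
        then show ?thesis
          using ag(1) N.commutator_mem_iff[of a g'] lower_central_Suc_mem[OF ag(1) g'(1)]
            L.mem_carrier by blast
      qed
      have "commutator G x y \<in> H" if xy: "x \<in> carrier G" "y \<in> carrier G" for x y
      proof -
        obtain h a where ha: "h \<in> H" "a \<in> lower_central G i" "x = h \<otimes> a" using form xy by blast
        obtain k b where kb: "k \<in> H" "b \<in> lower_central G i" "y = k \<otimes> b" using form xy by blast
        have G: "h \<in> carrier G" "a \<in> carrier G" "k \<in> carrier G" "b \<in> carrier G"
          using ha kb H.mem_carrier L.mem_carrier by auto
        interpret \<pi>: group_hom G "G Mod lower_central G (Suc i)" "\<lambda>a. lower_central G (Suc i) #> a"
          by (rule N.group_hom_Mod)
        \<comment> \<open>Modulo the next term, which lies in \<open>H\<close>, the factors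
          \<open>a\<close> and \<open>b\<close> are central. So the commutator of \<open>x\<close>
          and \<open>y\<close> differs from that of \<open>h\<close> and \<open>k\<close> by an
          element of \<open>H\<close>.\<close>
        have "lower_central G (Suc i) #> commutator G x y = lower_central G (Suc i) #> commutator G h k"
          unfolding ha(3) kb(3) using G ha(2) kb(2) cen
          by (simp only: N.commutator_r_coset[symmetric] m_closed \<pi>.hom_mult)
            (intro Q.commutator_central_factors \<pi>.hom_closed; simp)
        then have "commutator G x y \<in> lower_central G (Suc i) #> commutator G h k"
          using rcos_self[OF commutator_closed[OF xy] N.is_subgroup] by simp
        then obtain z where z: "z \<in> lower_central G (Suc i)" "commutator G x y = z \<otimes> commutator G h k"
          by (auto simp: r_coset_def)
        moreover have "commutator G h k \<in> H"
          using ha kb unfolding commutator_def by blast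
        ultimately show ?thesis using Suc.prems(2) by auto
      qed
      then have "lower_central G 1 \<subseteq> H"
        unfolding One_nat_def lower_central_Suc
        by (intro generate_subgroup_incl Suc.prems(1)) auto
      then show ?thesis by (rule base)
    qed
  qed
  show ?thesis
    \<comment> \<open>The induction starts from the trivial term \<open>c\<close>, which every
      subgroup contains.\<close>
    by (rule step[OF H _ ab, of c]) (simp_all add: c subgroup.one_closed[OF H])
qed

lemma comm_group_abelianization: "comm_group (G Mod lower_central G 1)"
proof -
  have "{commutator G x y | x y. x \<in> carrier G \<and> y \<in> carrier G} =
      (\<Union>x\<in>carrier G. \<Union>y\<in>carrier G. {x \<otimes> y \<otimes> inv x \<otimes> inv y})"
    by (auto simp: commutator_def)
  then have "lower_central G 1 = derived G (carrier G)"
    by (simp add: derived_def lower_central_Suc)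
  then show ?thesis using derived_quot_is_comm_group by simp
qed

end

section \<open>Abelian groups: exponents modulo a subgroup\<close>

context comm_group
begin

lemma subgroup_times_powers:
  assumes K: "subgroup K G" and x: "x \<in> carrier G"
  shows "subgroup {k \<otimes> x [^] (i::int) | k i. k \<in> K} G"
proof (rule subgroupI)
  interpret K: subgroup K G by (rule K)
  let ?M = "{k \<otimes> x [^] (i::int) | k i. k \<in> K}"
  show "?M \<subseteq> carrier G" using x K.mem_carrier by auto
  show "?M \<noteq> {}" using K.one_closed by blast
  fix a assume "a \<in> ?M"
  then obtain k i where a: "k \<in> K" "a = k \<otimes> x [^] (i::int)" by blast
  then have "inv a = inv k \<otimes> x [^] (-i)"
    using x K.mem_carrier by (simp add: inv_mult int_pow_neg)
  then show "inv a \<in> ?M" using a(1) by blast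
next
  interpret K: subgroup K G by (rule K)
  let ?M = "{k \<otimes> x [^] (i::int) | k i. k \<in> K}"
  fix a b assume "a \<in> ?M" "b \<in> ?M"
  then obtain k i l j where ab: "k \<in> K" "a = k \<otimes> x [^] (i::int)" "l \<in> K" "b = l \<otimes> x [^] (j::int)" by blast
  have "a \<otimes> b = (k \<otimes> l) \<otimes> (x [^] i \<otimes> x [^] j)"
    using ab x K.mem_carrier by (simp add: m_ac)
  also have "\<dots> = (k \<otimes> l) \<otimes> x [^] (i + j)" using x by (simp add: int_pow_mult)
  finally show "a \<otimes> b \<in> ?M" using ab by blast
qed

text \<open>A form of Nakayama's lemma: the quotient by \<open>K\<close> is finitely generated and
  every generator is an \<open>n\<close>-th power in it, so an integer congruent to 1 modulo
  \<open>n\<close> kills it. Instead of a determinant, the proof adjoins the generators to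
  \<open>K\<close> one at a time.\<close>

lemma finite_exponent_modulo_subgroup:
  fixes n :: int
  shows "finite X \<Longrightarrow> X \<subseteq> carrier G \<Longrightarrow> subgroup K G \<Longrightarrow> generate G (K \<union> X) = carrier G \<Longrightarrow>
    (\<And>x. x \<in> X \<Longrightarrow> \<exists>h\<in>carrier G. \<exists>k\<in>K. x = h [^] n \<otimes> k) \<Longrightarrow>
    \<exists>D::int. n dvd D - 1 \<and> (\<forall>g\<in>carrier G. g [^] D \<in> K)"
proof (induction X arbitrary: K rule: finite_induct)
  case empty
  then have "K = carrier G"
    using generate_subgroup_incl[of K K] subgroup.subset[of K G] by auto
  then show ?case by (intro exI[of _ 1]) auto
next
  case (insert x X)
  interpret K: subgroup K G by (rule insert.prems(2))
  define K' where "K' = {k \<otimes> x [^] (i::int) | k i. k \<in> K}"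
  have x: "x \<in> carrier G" using insert.prems by simp
  have K': "subgroup K' G" unfolding K'_def by (rule subgroup_times_powers[OF insert.prems(2) x])
  have KK': "K \<subseteq> K'"
  proof
    fix k assume "k \<in> K"
    then have "k = k \<otimes> x [^] (0::int)" using K.mem_carrier by simp
    then show "k \<in> K'" unfolding K'_def using \<open>k \<in> K\<close> by blast
  qed
  have "x = \<one> \<otimes> x [^] (1::int)" using x by simp
  then have xK': "x \<in> K'" unfolding K'_def using K.one_closed by blast
  have sub: "K' \<union> X \<subseteq> carrier G" using K' insert.prems(1) subgroup.subset by blast
  have "generate G (K \<union> insert x X) \<subseteq> generate G (K' \<union> X)"
    using KK' xK' by (intro mono_generate) auto
  then have "generate G (K' \<union> X) = carrier G"
    using insert.prems(3) generate_incl[OF sub] by auto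
  moreover have "\<exists>h\<in>carrier G. \<exists>k\<in>K'. z = h [^] n \<otimes> k" if "z \<in> X" for z
    using insert.prems(4)[of z] that KK' by blast
  ultimately obtain D :: int where D: "n dvd D - 1" "\<And>g. g \<in> carrier G \<Longrightarrow> g [^] D \<in> K'"
    using insert.IH[OF _ K'] insert.prems(1) by auto
  obtain h k where hk: "h \<in> carrier G" "k \<in> K" "x = h [^] n \<otimes> k"
    using insert.prems(4)[of x] by blast
  \<comment> \<open>Substituted into \<open>x [^] D\<close> with
    \<open>x = h [^] n \<otimes> k\<close>, this leaves \<open>x [^] (c * n)\<close> up to a factor
    in \<open>K\<close>; hence \<open>x [^] (D - c * n)\<close> lies in \<open>K\<close>.\<close>
  obtain k' c where kc: "k' \<in> K" "h [^] D = k' \<otimes> x [^] (c::int)"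
    using D(2)[OF hk(1)] unfolding K'_def by blast
  have kG: "k \<in> carrier G" "k' \<in> carrier G" using hk kc K.mem_carrier by auto
  have "x [^] D = (h [^] D) [^] n \<otimes> k [^] D"
    using hk(1) kG by (subst hk(3)) (simp add: int_pow_distrib int_pow_pow mult.commute)
  also have "\<dots> = k' [^] n \<otimes> k [^] D \<otimes> x [^] (c * n)"
    unfolding kc(2) using kG x by (simp add: int_pow_distrib int_pow_pow m_ac)
  finally have "x [^] (D - c * n) = k' [^] n \<otimes> k [^] D"
    using x kG by (simp add: int_pow_diff m_assoc)
  then have xK: "x [^] (D - c * n) \<in> K"
    using hk(2) kc(1) insert.prems(2) subgroup_int_pow_closed by auto
  \<comment> \<open>The factor \<open>D\<close> brings every element into \<open>K'\<close>, and
    \<open>D - c * n\<close> then removes the remaining power of \<open>x\<close>. Both factors are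
    1 modulo \<open>n\<close>.\<close>
  define E where "E = D * (D - c * n)"
  have "g [^] E \<in> K" if g: "g \<in> carrier G" for g
  proof -
    obtain l j where lj: "l \<in> K" "g [^] D = l \<otimes> x [^] (j::int)"
      using D(2)[OF g] unfolding K'_def by blast
    have lG: "l \<in> carrier G" using lj K.mem_carrier by auto
    have "g [^] E = (l \<otimes> x [^] j) [^] (D - c * n)"
      unfolding E_def lj(2)[symmetric] using g by (simp add: int_pow_pow)
    also have "\<dots> = l [^] (D - c * n) \<otimes> (x [^] (D - c * n)) [^] j"
      using lG x by (simp add: int_pow_distrib int_pow_pow mult.commute)
    also have "\<dots> \<in> K"
      using subgroup_int_pow_closed[OF insert.prems(2)] lj(1) xK by (intro K.m_closed)
    finally show ?thesis .
  qed
  moreover have "n dvd E - 1"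
  proof -
    have "E - 1 = D * (D - 1) + (D - 1) - D * c * n"
      by (simp add: E_def algebra_simps)
    with D(1) show ?thesis
      by (simp only: dvd_add dvd_diff dvd_mult dvd_refl)
  qed
  ultimately show ?case by blast
qed

end

text \<open>The entries from \<open>d\<close> to \<open>2 * d - 1\<close> are changed first, which
  determines \<open>m\<close>. Only then is the prime \<open>q\<close> for changing the entries
  below \<open>d\<close> chosen.\<close>

lemma (in group) generating_tuple_avoiding:
  fixes W :: "nat word set"
  assumes nil: "nilpotent_group G" and g: "g \<in> UNIV \<rightarrow> carrier G"
    and gen: "generates G (g ` {..<d})" and k: "2 * d \<le> k" and W: "finite W"
    and nontor: "\<And>w. w \<in> W \<Longrightarrow> \<exists>t\<in>UNIV \<rightarrow> carrier G. word_eval G t w \<notin> torsion_subgroup G"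
  shows "\<exists>s\<in>UNIV \<rightarrow> carrier G. generates G (s ` {..<k}) \<and> (\<forall>w\<in>W. word_eval G s w \<noteq> \<one>)"
proof -
  obtain c where c: "lower_central G c = {\<one>}"
    using nil by (auto simp: nilpotent_group_def)
  have fg: "finitely_generated G" using gen by (auto simp: finitely_generated_def)
  interpret D: normal "lower_central G 1" G by (rule lower_central_normal)
  define A where "A = G Mod lower_central G 1"
  define \<pi> where "\<pi> = (\<lambda>a. lower_central G 1 #> a)"
  interpret A: comm_group A unfolding A_def by (rule comm_group_abelianization)
  interpret \<pi>: group_hom G A \<pi> unfolding A_def \<pi>_def by (rule D.group_hom_Mod)
  have gG: "g i \<in> carrier G" for i using g by auto
  have genA: "generate A (\<pi> ` g ` {..<d}) = carrier A"
    using D.generates_Mod[OF gen] by (simp add: generates_def A_def \<pi>_def)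
  obtain t where t: "t \<in> UNIV \<rightarrow> carrier G" "\<And>w. w \<in> W \<Longrightarrow> word_eval G t w \<notin> torsion_subgroup G"
    using nontorsion_simultaneous[OF nil fg W nontor] by blast
  have "prime (3::nat)" by simp
  then obtain e where e: "\<And>t'. \<forall>i. \<exists>h\<in>carrier G. t' i = t i \<otimes> h [^] (3 ^ e :: nat) \<Longrightarrow>
      \<forall>w\<in>W. word_eval G t' w \<notin> torsion_subgroup G"
    using nontorsion_perturb[OF nil fg _ t(1) W t(2)] by blast
  \<comment> \<open>Since \<open>g i \<otimes> b i = t (d + i)\<close> and \<open>n\<close> is 1
    modulo \<open>3 ^ e\<close>, the element \<open>z i\<close> differs from
    \<open>t (d + i)\<close> by a \<open>3 ^ e\<close>-th power.\<close>
  define n :: nat where "n = 1 + 3 ^ e"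
  define b where "b i = inv (g i) \<otimes> t (d + i)" for i
  define z where "z i = g i \<otimes> b i [^] n" for i
  define t1 where "t1 i = (if d \<le> i \<and> i < 2 * d then z (i - d) else t i)" for i
  have tG: "t i \<in> carrier G" for i using t(1) by auto
  have bG: "b i \<in> carrier G" and zG: "z i \<in> carrier G" for i using gG tG by (auto simp: b_def z_def)
  have t1G: "t1 i \<in> carrier G" for i using tG zG by (simp add: t1_def)
  have "\<exists>h\<in>carrier G. t1 i = t i \<otimes> h [^] (3 ^ e :: nat)" for i
  proof (cases "d \<le> i \<and> i < 2 * d")
    case True
    have "z (i - d) = g (i - d) \<otimes> (b (i - d) \<otimes> b (i - d) [^] (3 ^ e :: nat))"
      unfolding z_def n_def using bG nat_pow_mult[of "b (i - d)" 1 "3 ^ e"] by simp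
    also have "\<dots> = t i \<otimes> b (i - d) [^] (3 ^ e :: nat)"
      using bG[of "i - d"] gG[of "i - d"] tG True by (simp add: m_assoc[symmetric]) (simp add: b_def)
    finally show ?thesis using True bG by (auto simp: t1_def)
  next
    case False
    then show ?thesis using tG by (intro bexI[of _ \<one>]) (auto simp: t1_def)
  qed
  then have t1: "word_eval G t1 w \<notin> torsion_subgroup G" if "w \<in> W" for w using e that by blast
  define H where "H = generate A (\<pi> ` z ` {..<d})"
  have H: "subgroup H A" unfolding H_def using zG by (intro A.generate_is_subgroup) auto
  interpret H: subgroup H A by (rule H)
  have \<pi>z: "\<pi> (z i) \<in> H" if "i < d" for i unfolding H_def using that by (auto intro: generate.incl)
  \<comment> \<open>In the abelianization, \<open>g i\<close> is \<open>z i\<close> times an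
    \<open>n\<close>-th power, so modulo \<open>H\<close> every generator is an \<open>n\<close>-th
    power.\<close>
  have "\<exists>D::int. int n dvd D - 1 \<and> (\<forall>a\<in>carrier A. a [^]\<^bsub>A\<^esub> D \<in> H)"
  proof (rule A.finite_exponent_modulo_subgroup[of "\<pi> ` g ` {..<d}"])
    have "carrier A \<subseteq> generate A (H \<union> \<pi> ` g ` {..<d})"
      unfolding genA[symmetric] by (intro A.mono_generate) auto
    moreover have "H \<union> \<pi> ` g ` {..<d} \<subseteq> carrier A"
      using H.subset gG by auto
    ultimately show "generate A (H \<union> \<pi> ` g ` {..<d}) = carrier A"
      using A.generate_incl by blast
    fix x assume "x \<in> \<pi> ` g ` {..<d}"
    then obtain i where i: "i < d" "x = \<pi> (g i)" by auto
    have "\<pi> (z i) = \<pi> (g i) \<otimes>\<^bsub>A\<^esub> \<pi> (b i) [^]\<^bsub>A\<^esub> n"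
      unfolding z_def using gG bG by (simp add: \<pi>.hom_nat_pow)
    then have "x = inv\<^bsub>A\<^esub> (\<pi> (b i)) [^]\<^bsub>A\<^esub> int n \<otimes>\<^bsub>A\<^esub> \<pi> (z i)"
      using gG bG i(2) by (simp add: int_pow_int A.nat_pow_inv A.m_ac)
    with \<pi>z[OF i(1)] show "\<exists>h\<in>carrier A. \<exists>k\<in>H. x = h [^]\<^bsub>A\<^esub> int n \<otimes>\<^bsub>A\<^esub> k"
      using A.inv_closed[OF \<pi>.hom_closed[OF bG[of i]]] by blast
  qed (use gG H in auto)
  then obtain D :: int where D: "int n dvd D - 1" "\<And>a. a \<in> carrier A \<Longrightarrow> a [^]\<^bsub>A\<^esub> D \<in> H" by blast
  \<comment> \<open>Here \<open>n \<ge> 2\<close> matters: 0 is not congruent to 1 modulo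
    \<open>n\<close>.\<close>
  have "D \<noteq> 0"
  proof
    assume "D = 0"
    with D(1) have "n dvd 1" by (simp add: n_def)
    then show False by (simp add: n_def)
  qed
  define m where "m = nat \<bar>D\<bar>"
  have "m > 0" using \<open>D \<noteq> 0\<close> by (simp add: m_def)
  have m: "a [^]\<^bsub>A\<^esub> m \<in> H" if a: "a \<in> carrier A" for a
  proof (cases "D \<ge> 0")
    case True
    then have "D = int m" by (simp add: m_def)
    with D(2)[OF a] show ?thesis by (simp add: int_pow_int)
  next
    case False
    then have "D = - int m" by (simp add: m_def)
    then have "inv\<^bsub>A\<^esub> (a [^]\<^bsub>A\<^esub> m) \<in> H"
      using D(2)[OF a] A.int_pow_neg_int[OF a, of m] by simp
    then show ?thesis using H.m_inv_closed a by fastforce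
  qed
  obtain q where q: "prime q" "q > m" using bigger_prime by blast
  have "t1 \<in> UNIV \<rightarrow> carrier G" using t1G by auto
  then obtain e' where e': "\<And>t'. \<forall>i. \<exists>h\<in>carrier G. t' i = t1 i \<otimes> h [^] (q ^ e') \<Longrightarrow>
      \<forall>w\<in>W. word_eval G t' w \<notin> torsion_subgroup G"
    using nontorsion_perturb[OF nil fg q(1) _ W t1] by blast
  have "coprime m q"
    using q \<open>m > 0\<close> by (metis coprime_commute nat_dvd_not_less prime_imp_coprime_nat)
  \<comment> \<open>The exponent \<open>m * x\<close> is 0 modulo \<open>m\<close>, so
    \<open>s i\<close> and \<open>g i\<close> agree modulo \<open>H\<close> in the abelianization
    for \<open>i < d\<close>. It is 1 modulo \<open>q ^ e'\<close>, so \<open>s\<close> is an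
    admissible perturbation of \<open>t1\<close>.\<close>
  then obtain x y where xy: "m * x = q ^ e' * y + 1"
    using bezout_nat[of m "q ^ e'"] \<open>m > 0\<close> by auto
  define b' where "b' i = inv (g i) \<otimes> t1 i" for i
  define s where "s i = (if i < d then g i \<otimes> b' i [^] (m * x) else t1 i)" for i
  have b'G: "b' i \<in> carrier G" for i using gG t1G by (simp add: b'_def)
  have sG: "s i \<in> carrier G" for i using gG b'G t1G by (simp add: s_def)
  have "\<exists>h\<in>carrier G. s i = t1 i \<otimes> h [^] (q ^ e')" for i
  proof (cases "i < d")
    case True
    have "s i = g i \<otimes> (b' i \<otimes> b' i [^] (q ^ e' * y))"
      using True b'G nat_pow_mult[of "b' i" 1 "q ^ e' * y"] by (simp add: s_def xy)
    also have "\<dots> = t1 i \<otimes> (b' i [^] y) [^] (q ^ e')"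
      using gG[of i] b'G[of i] t1G[of i]
      by (simp add: m_assoc[symmetric] nat_pow_pow mult.commute) (simp add: b'_def)
    finally show ?thesis using b'G by blast
  next
    case False
    then show ?thesis using t1G by (intro bexI[of _ \<one>]) (auto simp: s_def)
  qed
  then have sW: "\<forall>w\<in>W. word_eval G s w \<notin> torsion_subgroup G" by (intro e') blast
  define P where "P = generate G (s ` {..<k})"
  have P: "subgroup P G" unfolding P_def using sG by (intro generate_is_subgroup) auto
  have \<pi>P: "subgroup (\<pi> ` P) A" by (rule \<pi>.subgroup_img_is_subgroup[OF P])
  interpret \<pi>P: subgroup "\<pi> ` P" A by (rule \<pi>P)
  have \<pi>s: "\<pi> (s i) \<in> \<pi> ` P" if "i < k" for i using that by (auto simp: P_def intro: generate.incl)
  \<comment> \<open>The second change leaves the entries from \<open>d\<close> on untouched, so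
    \<open>H\<close> lies in the image of \<open>P\<close>.\<close>
  have "\<pi> (z i) \<in> \<pi> ` P" if "i < d" for i
  proof -
    have "z i = s (d + i)" using that by (simp add: s_def t1_def)
    then show ?thesis using \<pi>s[of "d + i"] that k by simp
  qed
  then have HP: "H \<subseteq> \<pi> ` P"
    unfolding H_def by (intro A.generate_subgroup_incl \<pi>P) auto
  have "\<pi> (g i) \<in> \<pi> ` P" if i: "i < d" for i
  proof -
    define u where "u = (\<pi> (b' i) [^]\<^bsub>A\<^esub> m) [^]\<^bsub>A\<^esub> x"
    have "(\<pi> (b' i) [^]\<^bsub>A\<^esub> x) [^]\<^bsub>A\<^esub> m \<in> H" using b'G by (intro m) auto
    then have uH: "u \<in> H" using b'G by (simp add: u_def A.nat_pow_pow mult.commute)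
    have "\<pi> (s i) = \<pi> (g i) \<otimes>\<^bsub>A\<^esub> u"
      using i gG b'G by (simp add: s_def u_def \<pi>.hom_nat_pow A.nat_pow_pow)
    then have "\<pi> (g i) = \<pi> (s i) \<otimes>\<^bsub>A\<^esub> inv\<^bsub>A\<^esub> u"
      using gG uH H.mem_carrier by (simp add: A.m_assoc)
    also have "\<dots> \<in> \<pi> ` P"
      using uH HP \<pi>s[of i] i k by (intro \<pi>P.m_closed \<pi>P.m_inv_closed) auto
    finally show ?thesis .
  qed
  then have "generate A (\<pi> ` g ` {..<d}) \<subseteq> \<pi> ` P"
    by (intro A.generate_subgroup_incl \<pi>P) auto
  then have surj: "carrier A \<subseteq> \<pi> ` P" unfolding genA .
  have "P = carrier G"
  proof (rule subgroup_eq_carrier_of_abelianization[OF c P])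
    fix x assume x: "x \<in> carrier G"
    then obtain h where h: "h \<in> P" "\<pi> x = \<pi> h" using surj \<pi>.hom_closed by blast
    have hG: "h \<in> carrier G" using h(1) P subgroup.mem_carrier by fast
    have "\<pi> (inv h \<otimes> x) = \<one>\<^bsub>A\<^esub>" using x hG h(2) by simp
    then have "inv h \<otimes> x \<in> lower_central G 1"
      using x hG D.r_coset_eq_one_iff[of "inv h \<otimes> x"] by (simp add: \<pi>_def A_def)
    with h(1) show "\<exists>h\<in>P. inv h \<otimes> x \<in> lower_central G 1" by blast
  qed
  then have "generates G (s ` {..<k})" using sG by (auto simp: generates_def P_def)
  moreover have "\<forall>w\<in>W. word_eval G s w \<noteq> \<one>"
    using sW subgroup.one_closed[OF normal_imp_subgroup[OF torsion_subgroup_normal[OF nil]]] by auto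
  ultimately show ?thesis using sG by blast
qed

section \<open>Balls in Cayley graphs\<close>

text \<open>Words need not be reduced, so they spell all paths from the root, including those that
  backtrack.\<close>

definition bounded_words :: "'x set \<Rightarrow> nat \<Rightarrow> 'x word set"
  where "bounded_words A R = {w. fst ` set w \<subseteq> A \<and> length w \<le> R}"

lemma finite_bounded_words:
  assumes "finite A"
  shows "finite (bounded_words A R)"
proof (rule finite_subset)
  show "bounded_words A R \<subseteq> {w. set w \<subseteq> A \<times> UNIV \<and> length w \<le> R}"
    by (auto simp: bounded_words_def)
  show "finite {w. set w \<subseteq> A \<times> (UNIV :: bool set) \<and> length w \<le> R}"
    using assms by (intro finite_lists_length_le) auto
qed

context group
begin

lemma word_eval_in_carrier: "s ` fst ` set w \<subseteq> carrier G \<Longrightarrow> word_eval G s w \<in> carrier G"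
  by (rule word_eval_closed) auto

lemma letters_in_carrier:
  "s ` A \<subseteq> carrier G \<Longrightarrow> fst ` set w \<subseteq> A \<Longrightarrow> s ` fst ` set w \<subseteq> carrier G"
  by blast

lemma word_eval_append:
  assumes "s ` fst ` (set u \<union> set v) \<subseteq> carrier G"
  shows "word_eval G s (u @ v) = word_eval G s u \<otimes> word_eval G s v"
  using assms
proof (induction u)
  case Nil
  then show ?case by (simp add: word_eval_in_carrier)
next
  case (Cons l u)
  then have "word_eval G s u \<in> carrier G" "word_eval G s v \<in> carrier G" "s (fst l) \<in> carrier G"
    by (auto simp: image_Un word_eval_in_carrier)
  with Cons show ?case by (simp add: m_assoc)
qed

lemma word_eval_inverse:
  assumes "s ` fst ` set u \<subseteq> carrier G"
  shows "word_eval G s (rev (map inv_letter u)) = inv (word_eval G s u)"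
  using assms
proof (induction u)
  case (Cons l u)
  then have G: "word_eval G s u \<in> carrier G" "s (fst l) \<in> carrier G"
    by (auto simp: image_Un word_eval_in_carrier)
  have "word_eval G s (rev (map inv_letter u) @ [inv_letter l]) =
      word_eval G s (rev (map inv_letter u)) \<otimes> word_eval G s [inv_letter l]"
    using Cons.prems by (intro word_eval_append) (auto simp: image_image)
  moreover have "snd (inv_letter l) \<longleftrightarrow> \<not> snd l" by (simp add: inv_letter_def)
  ultimately show ?case using Cons G by (auto simp: inv_mult_group)
qed simp

lemma word_eval_in_generate:
  assumes "fst ` set w \<subseteq> A"
  shows "word_eval G s w \<in> generate G (s ` A)"
  using assms by (induction w) (auto intro: generate.intros)

lemma word_eval_eq_iff:
  assumes s: "s ` A \<subseteq> carrier G" and u: "u \<in> bounded_words A m" and v: "v \<in> bounded_words A n"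
  shows "word_eval G s u = word_eval G s v \<longleftrightarrow> word_eval G s (u @ rev (map inv_letter v)) = \<one>"
proof -
  have "fst ` set u \<subseteq> A" "fst ` set v \<subseteq> A" using u v by (simp_all add: bounded_words_def)
  note sub = this[THEN letters_in_carrier[OF s]]
  then have G: "word_eval G s u \<in> carrier G" "word_eval G s v \<in> carrier G"
    by (auto simp: image_Un word_eval_in_carrier)
  have "word_eval G s (u @ rev (map inv_letter v)) = word_eval G s u \<otimes> inv (word_eval G s v)"
    using sub by (subst word_eval_append) (auto simp: image_image word_eval_inverse)
  with G show ?thesis
    by (simp add: inv_solve_right')
qed

lemma adjacency_cayley_graph:
  assumes s: "s ` A \<subseteq> carrier G"
  shows "(u, v) \<in> adjacency (cayley_graph G (s ` A)) \<longleftrightarrow>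
    u \<in> carrier G \<and> (\<exists>l. fst l \<in> A \<and> v = u \<otimes> word_eval G s [l])"
proof
  assume "(u, v) \<in> adjacency (cayley_graph G (s ` A))"
  then obtain i where i: "i \<in> A" "(u \<in> carrier G \<and> v = u \<otimes> s i) \<or> (v \<in> carrier G \<and> u = v \<otimes> s i)"
    by (auto simp: adjacency_def cayley_graph_def)
  then have si: "s i \<in> carrier G" using s by auto
  from i(2) consider (forward) "u \<in> carrier G" "v = u \<otimes> s i" | (backward) "v \<in> carrier G" "u = v \<otimes> s i"
    by blast
  then show "u \<in> carrier G \<and> (\<exists>l. fst l \<in> A \<and> v = u \<otimes> word_eval G s [l])"
  proof cases
    case forward
    then have "fst (i, True) \<in> A \<and> v = u \<otimes> word_eval G s [(i, True)]" using i(1) si by simp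
    with forward(1) show ?thesis by blast
  next
    case backward
    then have "fst (i, False) \<in> A \<and> v = u \<otimes> word_eval G s [(i, False)]" "u \<in> carrier G"
      using i(1) si by (simp_all add: m_assoc)
    then show ?thesis by blast
  qed
next
  assume "u \<in> carrier G \<and> (\<exists>l. fst l \<in> A \<and> v = u \<otimes> word_eval G s [l])"
  then obtain i b where u: "u \<in> carrier G" "i \<in> A" "v = u \<otimes> word_eval G s [(i, b)]" by auto
  then have si: "s i \<in> carrier G" using s by auto
  show "(u, v) \<in> adjacency (cayley_graph G (s ` A))"
  proof (cases b)
    case True
    with u si show ?thesis by (auto simp: adjacency_def cayley_graph_def)
  next
    case False
    with u si have "u = v \<otimes> s i" "v \<in> carrier G" by (simp_all add: m_assoc)
    with u(2) show ?thesis by (auto simp: adjacency_def cayley_graph_def)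
  qed
qed

lemma adjacency_cayley_graph_relpow:
  assumes s: "s ` A \<subseteq> carrier G"
  shows "(\<one>, v) \<in> adjacency (cayley_graph G (s ` A)) ^^ n \<longleftrightarrow>
    (\<exists>w. fst ` set w \<subseteq> A \<and> length w = n \<and> v = word_eval G s w)"
proof (induction n arbitrary: v)
  case (Suc n)
  \<comment> \<open>A step in the graph extends a word at its end, while \<open>word_eval\<close>
    recurses from the front.\<close>
  have snoc: "word_eval G s (w @ [l]) = word_eval G s w \<otimes> word_eval G s [l]"
    if "fst ` set w \<subseteq> A" "fst l \<in> A" for w l
    using letters_in_carrier[OF s, of "w @ [l]"] that by (intro word_eval_append) auto
  have cl: "word_eval G s w \<in> carrier G" if "fst ` set w \<subseteq> A" for w
    using letters_in_carrier[OF s that] by (rule word_eval_in_carrier)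
  have "(\<one>, v) \<in> adjacency (cayley_graph G (s ` A)) ^^ Suc n \<longleftrightarrow>
      (\<exists>w l. fst ` set w \<subseteq> A \<and> length w = n \<and> fst l \<in> A \<and> v = word_eval G s w \<otimes> word_eval G s [l])"
    (is "_ \<longleftrightarrow> ?R")
  proof
    assume "(\<one>, v) \<in> adjacency (cayley_graph G (s ` A)) ^^ Suc n"
    then obtain x where x: "(\<one>, x) \<in> adjacency (cayley_graph G (s ` A)) ^^ n"
      "(x, v) \<in> adjacency (cayley_graph G (s ` A))" by auto
    then obtain w l where "fst ` set w \<subseteq> A" "length w = n" "x = word_eval G s w"
      "fst l \<in> A" "v = x \<otimes> word_eval G s [l]"
      unfolding Suc.IH adjacency_cayley_graph[OF s] by blast
    then show ?R by blast
  next
    assume ?R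
    then obtain w l where w: "fst ` set w \<subseteq> A" "length w = n" "fst l \<in> A"
      "v = word_eval G s w \<otimes> word_eval G s [l]" by blast
    have "(\<one>, word_eval G s w) \<in> adjacency (cayley_graph G (s ` A)) ^^ n"
      unfolding Suc.IH using w(1,2) by blast
    moreover have "(word_eval G s w, v) \<in> adjacency (cayley_graph G (s ` A))"
      unfolding adjacency_cayley_graph[OF s] using w(3,4) cl[OF w(1)] by blast
    ultimately show "(\<one>, v) \<in> adjacency (cayley_graph G (s ` A)) ^^ Suc n" by auto
  qed
  also have "\<dots> \<longleftrightarrow> (\<exists>w. fst ` set w \<subseteq> A \<and> length w = Suc n \<and> v = word_eval G s w)"
  proof
    assume "\<exists>w l. fst ` set w \<subseteq> A \<and> length w = n \<and> fst l \<in> A \<and> v = word_eval G s w \<otimes> word_eval G s [l]"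
    then obtain w l where "fst ` set w \<subseteq> A" "length w = n" "fst l \<in> A"
      "v = word_eval G s w \<otimes> word_eval G s [l]" by blast
    then show "\<exists>w. fst ` set w \<subseteq> A \<and> length w = Suc n \<and> v = word_eval G s w"
      by (intro exI[of _ "w @ [l]"]) (simp add: snoc del: word_eval.simps)
  next
    assume "\<exists>w. fst ` set w \<subseteq> A \<and> length w = Suc n \<and> v = word_eval G s w"
    then obtain w where w: "fst ` set w \<subseteq> A" "length w = Suc n" "v = word_eval G s w" by blast
    then obtain w' l where "w = w' @ [l]" by (cases w rule: rev_cases) auto
    with w show "\<exists>w l. fst ` set w \<subseteq> A \<and> length w = n \<and> fst l \<in> A \<and>
        v = word_eval G s w \<otimes> word_eval G s [l]"
      by (intro exI[of _ w'] exI[of _ l]) (simp add: snoc del: word_eval.simps)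
  qed
  finally show ?case .
qed auto

lemma ball_vertices_cayley_graph:
  assumes s: "s ` A \<subseteq> carrier G"
  shows "ball_vertices (cayley_graph G (s ` A)) R = word_eval G s ` bounded_words A R"
proof -
  have "word_eval G s w \<in> carrier G" if "fst ` set w \<subseteq> A" for w
    using letters_in_carrier[OF s that] by (rule word_eval_in_carrier)
  moreover have "vertices (cayley_graph G (s ` A)) = carrier G" "root (cayley_graph G (s ` A)) = \<one>"
    by (simp_all add: cayley_graph_def)
  ultimately show ?thesis
    unfolding ball_vertices_def bounded_words_def using adjacency_cayley_graph_relpow[OF s] by auto
qed

text \<open>Edges are expressed by equalities between evaluations of words, the statements that
  \<open>word_eval_eq_transfer\<close> carries from one group to another.\<close>

lemma edges_root_ball_cayley_graph:
  assumes s: "s ` A \<subseteq> carrier G"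
  shows "edges (root_ball (cayley_graph G (s ` A)) R) =
    {(word_eval G s u, s i, word_eval G s v) | u i v.
      u \<in> bounded_words A R \<and> i \<in> A \<and> v \<in> bounded_words A R \<and>
      word_eval G s (u @ [(i, True)]) = word_eval G s v}"
proof -
  have "word_eval G s (u @ [(i, True)]) = word_eval G s u \<otimes> s i" "word_eval G s u \<in> carrier G"
    if "u \<in> bounded_words A R" "i \<in> A" for u i
  proof -
    have "s ` fst ` set u \<subseteq> carrier G" "s i \<in> carrier G"
      using that s letters_in_carrier[OF s, of u] by (auto simp: bounded_words_def)
    then show "word_eval G s (u @ [(i, True)]) = word_eval G s u \<otimes> s i" "word_eval G s u \<in> carrier G"
      using word_eval_append[of s u "[(i, True)]"] by (simp_all add: image_Un word_eval_in_carrier)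
  qed
  note * = this
  have "edges (root_ball (cayley_graph G (s ` A)) R) =
      {(x, l, y). x \<in> carrier G \<and> l \<in> s ` A \<and> y = x \<otimes> l \<and>
        x \<in> word_eval G s ` bounded_words A R \<and> y \<in> word_eval G s ` bounded_words A R}"
    unfolding root_ball_def ball_vertices_cayley_graph[OF s]
    by (auto simp: cayley_graph_def)
  also have "\<dots> = {(word_eval G s u, s i, word_eval G s v) | u i v.
      u \<in> bounded_words A R \<and> i \<in> A \<and> v \<in> bounded_words A R \<and>
      word_eval G s (u @ [(i, True)]) = word_eval G s v}"
    (is "?L = ?R")
  proof (intro subset_antisym subsetI)
    fix e assume "e \<in> ?L"
    then obtain u i v where "u \<in> bounded_words A R" "i \<in> A" "v \<in> bounded_words A R"
      "e = (word_eval G s u, s i, word_eval G s v)" "word_eval G s v = word_eval G s u \<otimes> s i" by auto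
    moreover from this have "word_eval G s (u @ [(i, True)]) = word_eval G s v" using *[of u i] by simp
    ultimately show "e \<in> ?R" by blast
  next
    fix e assume "e \<in> ?R"
    then obtain u i v where "u \<in> bounded_words A R" "i \<in> A" "v \<in> bounded_words A R"
      "e = (word_eval G s u, s i, word_eval G s v)" "word_eval G s (u @ [(i, True)]) = word_eval G s v" by blast
    moreover from this have "word_eval G s v = word_eval G s u \<otimes> s i" "word_eval G s u \<in> carrier G"
      using *[of u i] by simp_all
    ultimately show "e \<in> ?L" by blast
  qed
  finally show ?thesis .
qed

end

text \<open>Two words have equal values when the first followed by the formal inverse of the second
  evaluates to the identity; this makes the lengths add.\<close>

lemma word_eval_eq_transfer:
  assumes "group G" "group H" "s ` A \<subseteq> carrier G" "t ` A \<subseteq> carrier H"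
    and agree: "\<And>w. w \<in> bounded_words A (m + n) \<Longrightarrow>
      word_eval G s w = \<one>\<^bsub>G\<^esub> \<longleftrightarrow> word_eval H t w = \<one>\<^bsub>H\<^esub>"
    and u: "u \<in> bounded_words A m" "v \<in> bounded_words A n"
  shows "word_eval G s u = word_eval G s v \<longleftrightarrow> word_eval H t u = word_eval H t v"
proof -
  have "u @ rev (map inv_letter v) \<in> bounded_words A (m + n)"
    using u by (auto simp: bounded_words_def image_image)
  then show ?thesis
    using group.word_eval_eq_iff[OF assms(1,3) u] group.word_eval_eq_iff[OF assms(2,4) u] agree
    by blast
qed

text \<open>The isomorphism sends the value of a word at \<open>s\<close> to its value at
  \<open>t\<close>. Agreement on short words makes this well defined, injective and compatible with
  edges.\<close>

lemma lgraph_isomorphic_via_cayley_graph: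
  assumes G: "group G" and H: "group H" and s: "s ` A \<subseteq> carrier G" and t: "t ` A \<subseteq> carrier H"
    and agree: "\<And>w. w \<in> bounded_words A (2 * R + 2) \<Longrightarrow>
      word_eval G s w = \<one>\<^bsub>G\<^esub> \<longleftrightarrow> word_eval H t w = \<one>\<^bsub>H\<^esub>"
    and \<phi>: "\<And>i. i \<in> A \<Longrightarrow> \<phi> (s i) = t i"
  shows "lgraph_isomorphic_via \<phi> (root_ball (cayley_graph G (s ` A)) R) (root_ball (cayley_graph H (t ` A)) R)"
proof -
  interpret G: group G by (rule G)
  interpret H: group H by (rule H)
  let ?B = "bounded_words A R"
  \<comment> \<open>Vertices compare words of lengths \<open>R\<close> and \<open>R\<close>, edges
    \<open>R + 1\<close> and \<open>R\<close>, and labels 1 and 1. The bound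
    \<open>2 * R + 2\<close> covers all three, even for \<open>R = 0\<close>.\<close>
  have eq: "word_eval G s u = word_eval G s v \<longleftrightarrow> word_eval H t u = word_eval H t v"
    if "u \<in> bounded_words A m" "v \<in> bounded_words A n" "m + n \<le> 2 * R + 2" for u v m n
    using that by (intro word_eval_eq_transfer[OF G H s t _ that(1,2)] agree) (auto simp: bounded_words_def)
  have snocB: "u @ [(i, True)] \<in> bounded_words A (R + 1)" if "u \<in> ?B" "i \<in> A" for u i
    using that by (auto simp: bounded_words_def)
  define f where "f x = word_eval H t (SOME w. w \<in> ?B \<and> word_eval G s w = x)" for x
  have f: "f (word_eval G s u) = word_eval H t u" if u: "u \<in> ?B" for u
  proof -
    let ?w = "SOME w. w \<in> ?B \<and> word_eval G s w = word_eval G s u"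
    have "?w \<in> ?B \<and> word_eval G s ?w = word_eval G s u"
      by (rule someI[of "\<lambda>w. w \<in> ?B \<and> word_eval G s w = word_eval G s u" u]) (use u in simp)
    then show ?thesis unfolding f_def using eq[of ?w R u R] u by simp
  qed
  have injf: "inj_on f (word_eval G s ` ?B)"
  proof (rule inj_onI)
    fix x y assume "x \<in> word_eval G s ` ?B" "y \<in> word_eval G s ` ?B" and fxy: "f x = f y"
    then obtain u v where "u \<in> ?B" "v \<in> ?B" "x = word_eval G s u" "y = word_eval G s v" by blast
    with fxy show "x = y" using eq[of u R v R] f by simp
  qed
  have inj\<phi>: "s i = s j" if "i \<in> A" "j \<in> A" "t i = t j" for i j
  proof -
    have "s i \<in> carrier G" "s j \<in> carrier G" "t i \<in> carrier H" "t j \<in> carrier H" using that s t by auto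
    then show ?thesis
      using eq[of "[(i, True)]" 1 "[(j, True)]" 1] that by (simp add: bounded_words_def)
  qed
  have vert: "vertices (root_ball (cayley_graph G (s ` A)) R) = word_eval G s ` ?B"
    "vertices (root_ball (cayley_graph H (t ` A)) R) = word_eval H t ` ?B"
    using G.ball_vertices_cayley_graph[OF s] H.ball_vertices_cayley_graph[OF t]
    by (simp_all add: root_ball_def)
  let ?E = "edges (root_ball (cayley_graph G (s ` A)) R)"
  let ?F = "\<lambda>(u, l, v). (f u, \<phi> l, f v)"
  have "bij_betw f (word_eval G s ` ?B) (word_eval H t ` ?B)"
    using injf f by (auto simp: bij_betw_def image_image cong: image_cong)
  moreover have "f \<one>\<^bsub>G\<^esub> = \<one>\<^bsub>H\<^esub>"
    using f[of "[]"] by (simp add: bounded_words_def)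
  moreover have "bij_betw ?F ?E (edges (root_ball (cayley_graph H (t ` A)) R))"
    unfolding bij_betw_def
  proof
    show "inj_on ?F ?E"
    proof (rule inj_onI)
      fix e e' assume "e \<in> ?E" "e' \<in> ?E" and F: "?F e = ?F e'"
      then obtain u i v u' i' v' where
        e: "e = (word_eval G s u, s i, word_eval G s v)" "u \<in> ?B" "i \<in> A" "v \<in> ?B" and
        e': "e' = (word_eval G s u', s i', word_eval G s v')" "u' \<in> ?B" "i' \<in> A" "v' \<in> ?B"
        unfolding G.edges_root_ball_cayley_graph[OF s] by blast
      have "f (word_eval G s u) = f (word_eval G s u')" "t i = t i'"
        "f (word_eval G s v) = f (word_eval G s v')"
        using F e e' \<phi> by auto
      note F' = this
      have "word_eval G s u = word_eval G s u'" "word_eval G s v = word_eval G s v'"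
        using e(2,4) e'(2,4) F'(1,3) by (auto intro!: inj_onD[OF injf])
      moreover have "s i = s i'" using e(3) e'(3) F'(2) by (rule inj\<phi>)
      ultimately show "e = e'" using e(1) e'(1) by simp
    qed
    show "?F ` ?E = edges (root_ball (cayley_graph H (t ` A)) R)"
    proof (intro subset_antisym subsetI)
      fix e assume "e \<in> ?F ` ?E"
      then obtain u i v where e: "e = ?F (word_eval G s u, s i, word_eval G s v)" "u \<in> ?B" "i \<in> A" "v \<in> ?B"
        "word_eval G s (u @ [(i, True)]) = word_eval G s v"
        unfolding G.edges_root_ball_cayley_graph[OF s] by blast
      then have "word_eval H t (u @ [(i, True)]) = word_eval H t v"
        using eq[OF snocB] by force
      then show "e \<in> edges (root_ball (cayley_graph H (t ` A)) R)"
        unfolding H.edges_root_ball_cayley_graph[OF t] using e f \<phi> by auto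
    next
      fix e assume "e \<in> edges (root_ball (cayley_graph H (t ` A)) R)"
      then obtain u i v where e: "e = (word_eval H t u, t i, word_eval H t v)" "u \<in> ?B" "i \<in> A" "v \<in> ?B"
        "word_eval H t (u @ [(i, True)]) = word_eval H t v"
        unfolding H.edges_root_ball_cayley_graph[OF t] by blast
      then have "word_eval G s (u @ [(i, True)]) = word_eval G s v"
        using eq[OF snocB] by force
      then have "(word_eval G s u, s i, word_eval G s v) \<in> ?E"
        unfolding G.edges_root_ball_cayley_graph[OF s] using e by blast
      moreover have "e = ?F (word_eval G s u, s i, word_eval G s v)"
        using e f \<phi> by simp
      ultimately show "e \<in> ?F ` ?E" by (rule rev_image_eqI)
    qed
  qed
  ultimately show ?thesis
    unfolding lgraph_isomorphic_via_def vert
    by (intro exI[of _ f]) (simp add: root_ball_def cayley_graph_def)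
qed

text \<open>Generating sets are handled as families over a fixed index set \<open>A\<close>, so
  labels are matched through their indices.\<close>

lemma preformsI:
  assumes G: "group G" and H: "group H" and A: "finite A" and t: "generates H (t ` A)"
    and ex: "\<And>n. \<exists>s. generates G (s ` A) \<and>
      (\<forall>w\<in>bounded_words A n. word_eval G s w = \<one>\<^bsub>G\<^esub> \<longleftrightarrow> word_eval H t w = \<one>\<^bsub>H\<^esub>)"
  shows "G \<leadsto> H"
proof -
  \<comment> \<open>Length \<open>2 * n + 2\<close> serves the ball of radius \<open>n\<close>,
    hence every \<open>R \<le> n\<close>. It also covers words of length two, so \<open>s n\<close>
    and \<open>t\<close> identify the same indices.\<close>
  have "\<exists>s. \<forall>n. generates G (s n ` A) \<and> (\<forall>w\<in>bounded_words A (2 * n + 2).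
      word_eval G (s n) w = \<one>\<^bsub>G\<^esub> \<longleftrightarrow> word_eval H t w = \<one>\<^bsub>H\<^esub>)"
    using ex by (intro choice allI)
  then obtain s where s: "\<And>n. generates G (s n ` A)"
    "\<And>n w. w \<in> bounded_words A (2 * n + 2) \<Longrightarrow> word_eval G (s n) w = \<one>\<^bsub>G\<^esub> \<longleftrightarrow> word_eval H t w = \<one>\<^bsub>H\<^esub>"
    by blast
  have sG: "s n ` A \<subseteq> carrier G" for n using s(1) by (simp add: generates_def)
  have tH: "t ` A \<subseteq> carrier H" using t by (simp add: generates_def)
  interpret G: group G by (rule G)
  interpret H: group H by (rule H)
  have eq: "s n i = s n j \<longleftrightarrow> t i = t j" if "i \<in> A" "j \<in> A" for n i j
  proof -
    have "word_eval G (s n) [(i, True)] = word_eval G (s n) [(j, True)] \<longleftrightarrow>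
        word_eval H t [(i, True)] = word_eval H t [(j, True)]"
      by (rule word_eval_eq_transfer[OF G H sG tH, where m = 1 and n = 1])
        (use that in \<open>auto simp: bounded_words_def intro!: s(2)\<close>)
    moreover have "s n i \<in> carrier G" "s n j \<in> carrier G" "t i \<in> carrier H" "t j \<in> carrier H"
      using that sG tH by auto
    ultimately show ?thesis by simp
  qed
  define \<phi> where "\<phi> n x = t (SOME i. i \<in> A \<and> s n i = x)" for n x
  have \<phi>: "\<phi> n (s n i) = t i" if "i \<in> A" for n i
  proof -
    have "(SOME j. j \<in> A \<and> s n j = s n i) \<in> A \<and> s n (SOME j. j \<in> A \<and> s n j = s n i) = s n i"
      by (rule someI[of "\<lambda>j. j \<in> A \<and> s n j = s n i" i]) (use that in simp)
    then show ?thesis unfolding \<phi>_def using eq that by blast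
  qed
  have "bij_betw (\<phi> n) (s n ` A) (t ` A)" for n
    unfolding bij_betw_def
  proof
    show "inj_on (\<phi> n) (s n ` A)" using \<phi> eq by (auto intro!: inj_onI)
    show "\<phi> n ` s n ` A = t ` A" using \<phi> by (force simp: image_image)
  qed
  moreover have "lgraph_isomorphic_via (\<phi> n)
      (root_ball (cayley_graph G (s n ` A)) R) (root_ball (cayley_graph H (t ` A)) R)"
    if "n \<ge> R" for n R
    using that by (intro lgraph_isomorphic_via_cayley_graph G H sG tH s(2) \<phi>)
      (auto simp: bounded_words_def)
  ultimately show ?thesis
    unfolding preforms_def using A t s(1)
    by (intro exI[of _ "t ` A"] exI[of _ "\<lambda>n. s n ` A"] exI[of _ \<phi>]) auto
qed

section \<open>Relatively free groups\<close>

lemma foldr_reduced_Cons_in_free_group: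
  "fst ` set w \<subseteq> A \<Longrightarrow> foldr reduced_Cons w [] \<in> carrier (free_group A)"
  using fst_set_foldr_reduced_Cons[of w "[]"] by (auto simp: free_group_def reduced_foldr)

lemma generator_in_free_group: "i \<in> A \<Longrightarrow> [(i, b)] \<in> carrier (free_group A)"
  by (auto simp: free_group_def reduced_def)

lemma inv_generator_free_group:
  assumes "i \<in> A"
  shows "inv\<^bsub>free_group A\<^esub> [(i, True)] = [(i, False)]"
proof -
  interpret F: group "free_group A" by (rule group_free_group)
  have "[(i, False)] \<otimes>\<^bsub>free_group A\<^esub> [(i, True)] = \<one>\<^bsub>free_group A\<^esub>"
    by (simp add: free_group_def inv_letter_def)
  then show ?thesis
    using generator_in_free_group[OF assms] by (intro F.inv_equality)
qed

lemma word_eval_free_group_generators: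
  assumes "fst ` set w \<subseteq> A" "\<And>i. i \<in> A \<Longrightarrow> x i = [(i, True)]"
  shows "word_eval (free_group A) x w = foldr reduced_Cons w []"
  using assms(1)
proof (induction w)
  case Nil
  then show ?case by (simp add: free_group_def)
next
  case (Cons l w)
  then have l: "fst l \<in> A" by simp
  have "(if snd l then x (fst l) else inv\<^bsub>free_group A\<^esub> (x (fst l))) = [l]"
    using assms(2)[OF l] inv_generator_free_group[OF l] by (cases l) auto
  moreover have "word_eval (free_group A) x w = foldr reduced_Cons w []" using Cons by simp
  moreover have "[l] \<otimes>\<^bsub>free_group A\<^esub> v = reduced_Cons l v" for v by (simp add: free_group_def)
  ultimately show ?case by simp
qed

context group
begin

lemma word_eval_reduce:
  assumes "g \<in> UNIV \<rightarrow> carrier G"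
  shows "word_eval G g (foldr reduced_Cons w []) = word_eval G g w"
  using assms word_eval_foldr[of w "[]" g] word_eval_closed[of w g] by auto

text \<open>A value of an identity maps under any evaluation to a value of the same identity in
  \<open>G\<close>, which is trivial. Conversely, a word that vanishes throughout \<open>G\<close>
  is an identity and is its own value at the free generators.\<close>

lemma verbal_subgroup_identities:
  fixes A :: "nat set"
  shows "verbal_subgroup (identities G) (free_group A) =
    {w \<in> carrier (free_group A). \<forall>g\<in>UNIV \<rightarrow> carrier G. word_eval G g w = \<one>}"
    (is "?V = ?N")
proof
  interpret F: group "free_group A" by (rule group_free_group)
  show "?V \<subseteq> ?N"
  proof
    fix v assume "v \<in> ?V"
    then have v: "v \<in> generate (free_group A)
        {word_eval (free_group A) h w | h w. w \<in> identities G \<and> h \<in> UNIV \<rightarrow> carrier (free_group A)}"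
      (is "_ \<in> generate _ ?X") by (simp add: verbal_subgroup_def)
    have X: "?X \<subseteq> carrier (free_group A)" by (auto intro!: F.word_eval_closed)
    have "word_eval G g v = \<one>" if g: "g \<in> UNIV \<rightarrow> carrier G" for g
    proof -
      interpret h: group_hom "free_group A" G "word_eval G g"
        using word_eval_hom[of g A] g group_free_group
        by (auto simp: group_hom_def group_hom_axioms_def is_group)
      have "generate (free_group A) ?X \<subseteq> kernel (free_group A) G (word_eval G g)"
      proof (rule F.generate_subgroup_incl[OF _ h.subgroup_kernel])
        show "?X \<subseteq> kernel (free_group A) G (word_eval G g)"
        proof
          fix z assume "z \<in> ?X"
          then obtain h w where z: "z = word_eval (free_group A) h w" "w \<in> identities G"
            "h \<in> UNIV \<rightarrow> carrier (free_group A)" by blast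
          have hF: "h i \<in> carrier (free_group A)" for i using z(3) by blast
          then have "word_eval G g z = word_eval G (\<lambda>i. word_eval G g (h i)) w"
            using h.word_eval_hom_image[of w h] z(1) by simp
          also have "\<dots> = \<one>"
            using z(2) h.hom_closed[OF hF] by (simp add: identities_def Pi_iff)
          finally show "z \<in> kernel (free_group A) G (word_eval G g)"
            using X \<open>z \<in> ?X\<close> by (auto simp: kernel_def)
        qed
      qed
      then show ?thesis using v by (auto simp: kernel_def)
    qed
    moreover have "v \<in> carrier (free_group A)" using F.generate_in_carrier[OF X v] .
    ultimately show "v \<in> ?N" by blast
  qed
  show "?N \<subseteq> ?V"
  proof
    fix w assume w: "w \<in> ?N"
    \<comment> \<open>Variables outside \<open>A\<close> do not occur in \<open>w\<close>; the empty
      word keeps the tuple inside the free group.\<close>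
    define x :: "nat \<Rightarrow> nat word" where "x i = (if i \<in> A then [(i, True)] else [])" for i
    have x: "x \<in> UNIV \<rightarrow> carrier (free_group A)"
      by (auto simp: x_def generator_in_free_group) (simp add: free_group_def)
    have "fst ` set w \<subseteq> A" "reduced w" using w by (auto simp: free_group_def)
    then have "word_eval (free_group A) x w = w"
      by (subst word_eval_free_group_generators) (auto simp: x_def foldr_reduced_Cons_Nil)
    moreover have "w \<in> identities G"
      using w by (auto simp: identities_def free_group_def)
    ultimately have "w \<in> {word_eval (free_group A) h w | h w.
        w \<in> identities G \<and> h \<in> UNIV \<rightarrow> carrier (free_group A)}"
      using x by (metis (mono_tags, lifting) mem_Collect_eq)
    then show "w \<in> ?V" unfolding verbal_subgroup_def by (rule generate.incl)
  qed
qed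

text \<open>By the preceding description it is the intersection of the kernels of all evaluations in
  \<open>G\<close>.\<close>

lemma verbal_subgroup_normal:
  fixes A :: "nat set"
  shows "verbal_subgroup (identities G) (free_group A) \<lhd> free_group A"
proof -
  interpret F: group "free_group A" by (rule group_free_group)
  have ker: "kernel (free_group A) G (word_eval G g) \<lhd> free_group A" if "g \<in> UNIV \<rightarrow> carrier G" for g
  proof -
    interpret h: group_hom "free_group A" G "word_eval G g"
      using word_eval_hom[of g A] that group_free_group
      by (auto simp: group_hom_def group_hom_axioms_def is_group)
    show ?thesis by (rule h.normal_kernel)
  qed
  have eq: "verbal_subgroup (identities G) (free_group A) =
      (\<Inter>g\<in>UNIV \<rightarrow> carrier G. kernel (free_group A) G (word_eval G g))"
    unfolding verbal_subgroup_identities by (auto simp: kernel_def intro!: exI[of _ "\<lambda>_. \<one>"])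
  show ?thesis
  proof (rule F.normal_invI)
    show "subgroup (verbal_subgroup (identities G) (free_group A)) (free_group A)"
      unfolding eq by (rule F.subgroups_Inter) (use ker normal_imp_subgroup in \<open>auto intro!: exI[of _ "\<lambda>_. \<one>"]\<close>)
    fix u v assume "u \<in> carrier (free_group A)" "v \<in> verbal_subgroup (identities G) (free_group A)"
    then show "u \<otimes>\<^bsub>free_group A\<^esub> v \<otimes>\<^bsub>free_group A\<^esub> inv\<^bsub>free_group A\<^esub> u
        \<in> verbal_subgroup (identities G) (free_group A)"
      unfolding eq using normal.inv_op_closed2[OF ker] by blast
  qed
qed

text \<open>This is the form that \<open>preformsI\<close> needs. The words may be unreduced, so
  membership in the verbal subgroup is tested on their reductions, which have the same
  values.\<close>

lemma relatively_free_group_presentation: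
  fixes k :: nat
  defines "V \<equiv> relatively_free_group (identities G) k"
  obtains t where "group V" "generates V (t ` {..<k})"
    "\<And>w. fst ` set w \<subseteq> {..<k} \<Longrightarrow>
      word_eval V t w = \<one>\<^bsub>V\<^esub> \<longleftrightarrow> (\<forall>g\<in>UNIV \<rightarrow> carrier G. word_eval G g w = \<one>)"
proof -
  let ?F = "free_group {..<k}"
  define N where "N = verbal_subgroup (identities G) ?F"
  have V: "V = ?F Mod N" by (simp add: V_def relatively_free_group_def N_def)
  interpret N: normal N ?F unfolding N_def by (rule verbal_subgroup_normal)
  interpret h: group_hom ?F "?F Mod N" "\<lambda>a. N #>\<^bsub>?F\<^esub> a" by (rule N.group_hom_Mod)
  define x :: "nat \<Rightarrow> nat word" where "x i = [(i, True)]" for i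
  have xF: "x i \<in> carrier ?F" if "i < k" for i
    using that by (simp add: x_def generator_in_free_group)
  have "carrier ?F \<subseteq> generate ?F (x ` {..<k})"
  proof
    fix w assume w: "w \<in> carrier ?F"
    then have "word_eval ?F x w = w" "fst ` set w \<subseteq> {..<k}"
      by (auto simp: free_group_def x_def foldr_reduced_Cons_Nil
          word_eval_free_group_generators[unfolded free_group_def])
    then show "w \<in> generate ?F (x ` {..<k})"
      using N.word_eval_in_generate[of w "{..<k}" x] by simp
  qed
  then have "generates ?F (x ` {..<k})"
    using xF N.generate_incl[of "x ` {..<k}"] by (auto simp: generates_def)
  from N.generates_Mod[OF this] have gen: "generates V ((\<lambda>i. N #>\<^bsub>?F\<^esub> x i) ` {..<k})"
    by (simp add: V image_image)
  have "word_eval V (\<lambda>i. N #>\<^bsub>?F\<^esub> x i) w = \<one>\<^bsub>V\<^esub> \<longleftrightarrow> (\<forall>g\<in>UNIV \<rightarrow> carrier G. word_eval G g w = \<one>)"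
    if w: "fst ` set w \<subseteq> {..<k}" for w
  proof -
    let ?r = "foldr reduced_Cons w []"
    have r: "?r \<in> carrier ?F" using w by (rule foldr_reduced_Cons_in_free_group)
    have "word_eval V (\<lambda>i. N #>\<^bsub>?F\<^esub> x i) w = N #>\<^bsub>?F\<^esub> word_eval ?F x w"
      unfolding V by (rule h.word_eval_hom_image) (use w xF in auto)
    also have "word_eval ?F x w = ?r"
      using w by (rule word_eval_free_group_generators) (simp add: x_def)
    finally have "word_eval V (\<lambda>i. N #>\<^bsub>?F\<^esub> x i) w = \<one>\<^bsub>V\<^esub> \<longleftrightarrow> ?r \<in> N"
      using N.r_coset_eq_one_iff[OF r] by (simp add: V)
    also have "\<dots> \<longleftrightarrow> (\<forall>g\<in>UNIV \<rightarrow> carrier G. word_eval G g ?r = \<one>)"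
      unfolding N_def verbal_subgroup_identities using r by simp
    also have "\<dots> \<longleftrightarrow> (\<forall>g\<in>UNIV \<rightarrow> carrier G. word_eval G g w = \<one>)"
      by (rule ball_cong) (simp_all only: word_eval_reduce)
    finally show ?thesis .
  qed
  moreover have "group V" unfolding V by (rule N.factorgroup_is_group)
  ultimately show ?thesis using gen that by blast
qed

text \<open>The hypothesis on identities enters here: a word that fails in \<open>G\<close> also
  fails in the torsion-free quotient, and a tuple witnessing this lifts to \<open>G\<close>.\<close>

lemma nonidentity_nontorsion:
  fixes w :: "nat word"
  assumes nil: "nilpotent_group G" and ids: "identities G = identities (G Mod torsion_subgroup G)"
    and w: "g \<in> UNIV \<rightarrow> carrier G" "word_eval G g w \<noteq> \<one>"
  shows "\<exists>t\<in>UNIV \<rightarrow> carrier G. word_eval G t w \<notin> torsion_subgroup G"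
proof -
  let ?r = "foldr reduced_Cons w []"
  interpret T: normal "torsion_subgroup G" G by (rule torsion_subgroup_normal[OF nil])
  interpret h: group_hom G "G Mod torsion_subgroup G" "\<lambda>a. torsion_subgroup G #> a"
    by (rule T.group_hom_Mod)
  \<comment> \<open>Only reduced words belong to \<open>identities\<close>, so \<open>w\<close> is
    replaced by its reduction.\<close>
  have r: "?r \<in> carrier (free_group UNIV)" by (rule foldr_reduced_Cons_in_free_group) simp
  have "word_eval G g ?r \<noteq> \<one>" using w(2) by (simp only: word_eval_reduce[OF w(1)] not_False_eq_True)
  then have "?r \<notin> identities G" using w(1) unfolding identities_def by blast
  then obtain u where u: "u \<in> UNIV \<rightarrow> carrier (G Mod torsion_subgroup G)"
    "word_eval (G Mod torsion_subgroup G) u ?r \<noteq> \<one>\<^bsub>G Mod torsion_subgroup G\<^esub>"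
    unfolding ids using r by (auto simp: identities_def)
  have "\<exists>a\<in>carrier G. u i = torsion_subgroup G #> a" for i
    using u(1) by (auto simp: carrier_FactGroup)
  then obtain t where t: "\<And>i. t i \<in> carrier G" "\<And>i. u i = torsion_subgroup G #> t i" by metis
  have tG: "t \<in> UNIV \<rightarrow> carrier G" using t(1) by auto
  have "word_eval (G Mod torsion_subgroup G) u ?r = torsion_subgroup G #> word_eval G t ?r"
    using h.word_eval_hom_image[of ?r t] t by presburger
  then have "word_eval G t ?r \<notin> torsion_subgroup G"
    using u(2) T.r_coset_eq_one_iff[OF word_eval_closed[of ?r t]] t(1) by auto
  then show ?thesis using tG word_eval_reduce[OF tG] by auto
qed

end

theorem theorem1:
  fixes G :: "('a, 'm) monoid_scheme"
  assumes "group G" and "finitely_generated G" and "nilpotent_group G"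
    and "identities G = identities (G Mod torsion_subgroup G)"
  shows "\<exists>k\<^sub>0. \<forall>k\<ge>k\<^sub>0. G \<leadsto> relatively_free_group (identities G) k"
proof -
  interpret group G by (rule assms(1))
  obtain S where S: "finite S" "generates G S"
    using assms(2) by (auto simp: finitely_generated_def)
  obtain d g0 where g0: "S = g0 ` {..<d::nat}"
    using finite_imp_nat_seg_image_inj_on[OF S(1)] by (auto simp: lessThan_def)
  define g where "g i = (if i < d then g0 i else \<one>\<^bsub>G\<^esub>)" for i
  have gS: "g ` {..<d} = S" by (simp add: g_def g0)
  have "g i \<in> carrier G" for i
    using S(2) gS by (cases "i < d") (auto simp: generates_def g_def)
  then have g: "g \<in> UNIV \<rightarrow> carrier G" by blast
  \<comment> \<open>The bound \<open>2 * d\<close> leaves room for the two blocks of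
    \<open>d\<close> entries in \<open>generating_tuple_avoiding\<close>.\<close>
  have "G \<leadsto> relatively_free_group (identities G) k" if k: "k \<ge> 2 * d" for k
  proof -
    obtain t where t: "group (relatively_free_group (identities G) k)"
      "generates (relatively_free_group (identities G) k) (t ` {..<k})"
      "\<And>w. fst ` set w \<subseteq> {..<k} \<Longrightarrow>
        word_eval (relatively_free_group (identities G) k) t w =
          \<one>\<^bsub>relatively_free_group (identities G) k\<^esub> \<longleftrightarrow>
        (\<forall>g\<in>UNIV \<rightarrow> carrier G. word_eval G g w = \<one>\<^bsub>G\<^esub>)"
      using relatively_free_group_presentation[of k] by blast
    show ?thesis
    proof (rule preformsI[OF assms(1) t(1) _ t(2)])
      fix n
      \<comment> \<open>Words outside \<open>W\<close> vanish at every tuple of \<open>G\<close>, so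
        avoiding zeros on \<open>W\<close> settles all words of length at most
        \<open>n\<close>.\<close>
      define W where "W = {w \<in> bounded_words {..<k} n. \<exists>g\<in>UNIV \<rightarrow> carrier G. word_eval G g w \<noteq> \<one>\<^bsub>G\<^esub>}"
      have "finite W" by (simp add: W_def finite_bounded_words)
      moreover have "\<exists>t\<in>UNIV \<rightarrow> carrier G. word_eval G t w \<notin> torsion_subgroup G" if w: "w \<in> W" for w
        using w nonidentity_nontorsion[OF assms(3,4)] by (auto simp: W_def)
      moreover have "generates G (g ` {..<d})" using S(2) gS by simp
      ultimately have "\<exists>s\<in>UNIV \<rightarrow> carrier G. generates G (s ` {..<k}) \<and> (\<forall>w\<in>W. word_eval G s w \<noteq> \<one>\<^bsub>G\<^esub>)"
        using k by (intro generating_tuple_avoiding[OF assms(3) g])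
      then obtain s where s: "s \<in> UNIV \<rightarrow> carrier G" "generates G (s ` {..<k})"
        "\<And>w. w \<in> W \<Longrightarrow> word_eval G s w \<noteq> \<one>\<^bsub>G\<^esub>"
        by blast
      have "word_eval G s w = \<one>\<^bsub>G\<^esub> \<longleftrightarrow> (\<forall>g\<in>UNIV \<rightarrow> carrier G. word_eval G g w = \<one>\<^bsub>G\<^esub>)"
        if "w \<in> bounded_words {..<k} n" for w
        using s(1,3) that unfolding W_def by blast
      then show "\<exists>s. generates G (s ` {..<k}) \<and> (\<forall>w\<in>bounded_words {..<k} n.
          word_eval G s w = \<one>\<^bsub>G\<^esub> \<longleftrightarrow> word_eval (relatively_free_group (identities G) k) t w =
            \<one>\<^bsub>relatively_free_group (identities G) k\<^esub>)"
        using s(2) t(3) by (auto simp: bounded_words_def)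
    qed simp
  qed
  then show ?thesis by blast
qed

end
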